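(* Let $\mathcal{A},\mathcal{B}$ be max-plus automata over the same finite alphabet $\Sigma$ such that $\mathcal{A}$ is deterministic and $[\![\mathcal{B}]\!](w)\in\mathbb{N}$ for all $w\in\Sigma^*$. The following assertions are equivalent: (i) $\mathcal{A}$ is big-O of $\mathcal{B}$, i.e. there is a positive integer $c$ such that $[\![\mathcal{A}]\!](w)\le c\,[\![\mathcal{B}]\!](w)+c$ for all $w\in\Sigma^*$; (ii) there is no witness of non-domination in $\mathfrak{M}_{\mathcal{A},\mathcal{B}}$; (iii) there is no tractable witness of non-domination in $\mathfrak{M}_{\mathcal{A},\mathcal{B}}$.
   Context: **Automata.** $\mathbb{N}_{\max}=\mathbb{N}\cup\{-\infty\}$ with $\max$ and $+$; matrix product $(A\otimes B)_{q,q'}=\max_{q''}(A_{q,q''}+B_{q'',q'})$. A max-plus automaton is $\langle Q,\Sigma,M,I,F\rangle$ with $Q$, $\Sigma$ finite, $M:\Sigma\to\mathbb{N}_{\max}^{Q\times Q}$, $I\in\mathbb{N}_{\max}^{1\times Q}$, $F\in\mathbb{N}_{\max}^{Q\times 1}$; $[\![\mathcal{A}]\!](w_1\cdots w_k)=I\otimes M(w_1)\otimes\cdots\otimes M(w_k)\otimes F$. It is deterministic if $I$ has at most one entry $\ne-\infty$ and each row of each $M(a)$ has at most one entry $\neq-\infty$. A state $p$ is initial if $I_p\neq-\infty$, final if $F_p\ne-\infty$; all states are assumed accessible and co-accessible. Write $p\xrightarrow{a:x}q$ if $M(a)_{p,q}=x\ne-\infty$. Data of $\mathcal{A}$, $\mathcal{B}$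 are indexed by $\mathcal{A}$, $\mathcal{B}$. **Semirings.** $\Omega=\{-\infty,0,1,\infty\}$ with $\max$ for the order $-\infty<0<1<\infty$ and commutative sum: $-\infty+x=-\infty$ for all $x$, $0+x=x$, $1+1=1$, $1+\infty=\infty+\infty=\infty$. $\overline{\Omega}=\{-\infty,0,1\}$ is the subsemiring. The bar map sends $-\infty\mapsto-\infty$, $0\mapsto0$, and every positive integer and $\infty$ to $1$; it is applied entrywise to matrices. Matrix products over $\Omega$ are written $\otimes$. **Semigroups.** $\mathfrak{M}_{Q_{\mathcal{A}},|Q_{\mathcal{B}}|}$ is the set of tuples $(p,x,q,M)$ with $p,q\in Q_{\mathcal{A}}$, $x\in\Omega$, $M\in\Omega^{Q_{\mathcal{B}}\times Q_{\mathcal{B}}}$, together with an absorbing element $\bot$; the product is $(p,x,q,M)\otimes(p',x',q',M')=(p,x+x',q',M\otimes M')$ if $q=p'$, and $\bot$ otherwise. A matrix $M$ is path-idempotent if $\overline{M}\otimes\overline{M}=\overline{M}$; $(p,x,q,M)$ is path-idempotent if $p=q$ and $M$ is path-idempotent. Stabilisation: on $\Omega$, $(-\infty)^\sharp=-\infty$, $0^\sharp=0$, $1^\sharp=\infty^\sharp=\infty$. For $M$ path-idempotent, $M^\sharp=M\otimes M'\otimes M$, where $M'$ is $M$ with each diagonal entry replaced by its stabilisation; $(p,x,p,M)^\sharp=(p,x^\sharp,p,M^\sharp)$. Flattening: for $M$ path-idempotent, $M^\flat=\overline{M}\otimes\langle M^3\rangle\otimes\overline{M}$, where $\langle N\rangle$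 is $N$ with all non-diagonal entries replaced by their barred versions; $(p,x,p,M)^\flat=(p,x,p,M^\flat)$. Let $X=\{(p,\overline{x},q,\overline{M_{\mathcal{B}}(a)})\mid a\in\Sigma,\ p\xrightarrow{a:x}q\text{ in }\mathcal{A}\}$. $\overline{\mathfrak{M}}_{\mathcal{A},\mathcal{B}}$ is the subsemigroup generated by $X$ under product. $\mathfrak{M}_{\mathcal{A},\mathcal{B}}$ is the smallest subset containing $X$ closed under product and under stabilisation and flattening of its path-idempotent elements. **Witnesses.** $(p,x,q,M)\in\mathfrak{M}_{\mathcal{A},\mathcal{B}}$ is a witness of non-domination if $p$ is initial in $\mathcal{A}$, $q$ is final in $\mathcal{A}$, $x=\infty$, and $\overline{I_{\mathcal{B}}}\otimes M\otimes\overline{F_{\mathcal{B}}}<\infty$. It is a tractable witness of non-domination if moreover it is of the form $$g_0(g_1(\cdots(g_{k-2}(g_{k-1}(g_k)^\sharp g'_{k-1})^\flat g'_{k-2})^\flat\cdots)^\flat g_1')^\flat g_0'$$ (one $\sharp$, innermost, and $k-1$ nested $\flat$; every $\sharp$ and $\flat$ applied to a path-idempotent element), with $k\le 3|\overline{\mathfrak{M}}_{\mathcal{A},\mathcal{B}}|$ and all $g_i,g_i'\in\overline{\mathfrak{M}}_{\mathcal{A},\mathcal{B}}\cup\{\mathsf{id}\}$, where $\mathsf{id}$ is an added identity element. *)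

theory Defs
  imports Main
begin

section \<open>The max-plus semiring of natural numbers\<close>

datatype nmax = MInf | Fin nat

instantiation nmax :: "{linorder, order_bot, ordered_comm_monoid_add}"
begin

fun less_eq_nmax :: "nmax \<Rightarrow> nmax \<Rightarrow> bool" where
  "MInf \<le> (y::nmax) \<longleftrightarrow> True"
| "Fin m \<le> MInf \<longleftrightarrow> False"
| "Fin m \<le> Fin n \<longleftrightarrow> m \<le> n"

definition less_nmax :: "nmax \<Rightarrow> nmax \<Rightarrow> bool" where
  "x < y \<longleftrightarrow> x \<le> y \<and> \<not> y \<le> (x::nmax)"

definition bot_nmax :: nmax where "bot_nmax = MInf"

definition zero_nmax :: nmax where "zero_nmax = Fin 0"

fun plus_nmax :: "nmax \<Rightarrow> nmax \<Rightarrow> nmax" where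
  "Fin m + Fin n = Fin (m + n)"
| "(x::nmax) + y = MInf"

instance
proof
  fix x y z :: nmax
  show "x < y \<longleftrightarrow> x \<le> y \<and> \<not> y \<le> x" by (rule less_nmax_def)
  show "x \<le> x" by (cases x) auto
  show "x \<le> y \<Longrightarrow> y \<le> z \<Longrightarrow> x \<le> z" by (cases x; cases y; cases z) auto
  show "x \<le> y \<Longrightarrow> y \<le> x \<Longrightarrow> x = y" by (cases x; cases y) auto
  show "x \<le> y \<or> y \<le> x" by (cases x; cases y) auto
  show "bot \<le> x" by (simp add: bot_nmax_def)
  show "x + y + z = x + (y + z)" by (cases x; cases y; cases z) auto
  show "x + y = y + x" by (cases x; cases y) auto
  show "0 + x = x" by (cases x) (auto simp: zero_nmax_def)
  show "x \<le> y \<Longrightarrow> z + x \<le> z + y" by (cases x; cases y; cases z) auto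
qed

end

text \<open>Multiplication by a positive integer.\<close>

fun scale :: "nat \<Rightarrow> nmax \<Rightarrow> nmax" where
  "scale c MInf = MInf"
| "scale c (Fin n) = Fin (c * n)"


section \<open>The semiring \<open>\<Omega>\<close>\<close>

datatype omega = OMInf | OZero | OOne | OInf

instantiation omega :: "{linorder, order_bot, ordered_comm_monoid_add}"
begin

fun rank_omega :: "omega \<Rightarrow> nat" where
  "rank_omega OMInf = 0"
| "rank_omega OZero = 1"
| "rank_omega OOne = 2"
| "rank_omega OInf = 3"

definition less_eq_omega :: "omega \<Rightarrow> omega \<Rightarrow> bool" where
  "x \<le> y \<longleftrightarrow> rank_omega x \<le> rank_omega y"

definition less_omega :: "omega \<Rightarrow> omega \<Rightarrow> bool" where
  "x < y \<longleftrightarrow> rank_omega x < rank_omega y"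

definition bot_omega :: omega where "bot_omega = OMInf"

definition zero_omega :: omega where "zero_omega = OZero"

fun plus_omega :: "omega \<Rightarrow> omega \<Rightarrow> omega" where
  "OMInf + x = OMInf"
| "x + OMInf = OMInf"
| "OZero + x = x"
| "x + OZero = x"
| "OOne + OOne = OOne"
| "OOne + OInf = OInf"
| "OInf + OOne = OInf"
| "OInf + OInf = OInf"

instance
proof
  fix x y z :: omega
  show "x < y \<longleftrightarrow> x \<le> y \<and> \<not> y \<le> x" by (auto simp: less_eq_omega_def less_omega_def)
  show "x \<le> x" by (simp add: less_eq_omega_def)
  show "x \<le> y \<Longrightarrow> y \<le> z \<Longrightarrow> x \<le> z" by (simp add: less_eq_omega_def)
  show "x \<le> y \<Longrightarrow> y \<le> x \<Longrightarrow> x = y" by (cases x; cases y) (auto simp: less_eq_omega_def)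
  show "x \<le> y \<or> y \<le> x" by (auto simp: less_eq_omega_def)
  show "bot \<le> x" by (simp add: less_eq_omega_def bot_omega_def)
  show "x + y + z = x + (y + z)" by (cases x; cases y; cases z) auto
  show "x + y = y + x" by (cases x; cases y) auto
  show "0 + x = x" by (cases x) (auto simp: zero_omega_def)
  show "x \<le> y \<Longrightarrow> z + x \<le> z + y" by (cases x; cases y; cases z) (auto simp: less_eq_omega_def)
qed

end

fun nbar :: "nmax \<Rightarrow> omega" where
  "nbar MInf = OMInf"
| "nbar (Fin n) = (if n = 0 then OZero else OOne)"

fun obar :: "omega \<Rightarrow> omega" where
  "obar OMInf = OMInf"
| "obar OZero = OZero"
| "obar OOne = OOne"
| "obar OInf = OOne"

fun osharp :: "omega \<Rightarrow> omega" where
  "osharp OMInf = OMInf"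
| "osharp OZero = OZero"
| "osharp OOne = OInf"
| "osharp OInf = OInf"


section \<open>Vectors and matrices\<close>

text \<open>
  A matrix indexed by \<open>Q \<times> Q\<close>, for a finite set \<open>Q\<close>, is a function with the value
  \<open>-\<infinity>\<close> outside \<open>Q \<times> Q\<close>, and likewise for vectors; all operations below
  preserve this, so that equality of matrices is equality of functions.
  The set \<open>Q\<close> may be empty, and the empty maximum is \<open>-\<infinity>\<close>.
\<close>

type_synonym ('q, 'x) matr = "'q \<Rightarrow> 'q \<Rightarrow> 'x"

definition bigmax :: "'q set \<Rightarrow> ('q \<Rightarrow> 'x::{linorder,order_bot}) \<Rightarrow> 'x" where
  "bigmax Q f = Max (insert bot (f ` Q))"

definition mat_mult ::
  "'q set \<Rightarrow> ('q, 'x::{linorder,order_bot,plus}) matr \<Rightarrow> ('q, 'x) matr \<Rightarrow> ('q, 'x) matr" where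
  "mat_mult Q M N = (\<lambda>p q. bigmax Q (\<lambda>r. M p r + N r q))"

definition vec_mat_mult ::
  "'q set \<Rightarrow> ('q \<Rightarrow> 'x::{linorder,order_bot,plus}) \<Rightarrow> ('q, 'x) matr \<Rightarrow> ('q \<Rightarrow> 'x)" where
  "vec_mat_mult Q v M = (\<lambda>q. bigmax Q (\<lambda>p. v p + M p q))"

definition vec_mult ::
  "'q set \<Rightarrow> ('q \<Rightarrow> 'x::{linorder,order_bot,plus}) \<Rightarrow> ('q \<Rightarrow> 'x) \<Rightarrow> 'x" where
  "vec_mult Q v u = bigmax Q (\<lambda>q. v q + u q)"


section \<open>Max-plus automata\<close>

record ('q, 'a) automaton =
  states :: "'q set"
  alphabet :: "'a set"
  mat :: "'a \<Rightarrow> ('q, nmax) matr"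
  ini :: "'q \<Rightarrow> nmax"
  fin :: "'q \<Rightarrow> nmax"

definition initial :: "('q, 'a) automaton \<Rightarrow> 'q \<Rightarrow> bool" where
  "initial A p \<longleftrightarrow> p \<in> states A \<and> ini A p \<noteq> MInf"

definition final :: "('q, 'a) automaton \<Rightarrow> 'q \<Rightarrow> bool" where
  "final A p \<longleftrightarrow> p \<in> states A \<and> fin A p \<noteq> MInf"

definition edges :: "('q, 'a) automaton \<Rightarrow> ('q \<times> 'q) set" where
  "edges A = {(p, q). p \<in> states A \<and> q \<in> states A \<and> (\<exists>a\<in>alphabet A. mat A a p q \<noteq> MInf)}"

definition accessible :: "('q, 'a) automaton \<Rightarrow> 'q \<Rightarrow> bool" where
  "accessible A q \<longleftrightarrow> (\<exists>p. initial A p \<and> (p, q) \<in> (edges A)\<^sup>*)"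

definition co_accessible :: "('q, 'a) automaton \<Rightarrow> 'q \<Rightarrow> bool" where
  "co_accessible A q \<longleftrightarrow> (\<exists>r. final A r \<and> (q, r) \<in> (edges A)\<^sup>*)"

locale max_plus_automaton =
  fixes A :: "('q, 'a) automaton"
  assumes finite_states: "finite (states A)"
    and finite_alphabet: "finite (alphabet A)"
    and mat_support: "\<And>a p q. a \<in> alphabet A \<Longrightarrow> p \<notin> states A \<or> q \<notin> states A \<Longrightarrow> mat A a p q = MInf"
    and ini_support: "\<And>p. p \<notin> states A \<Longrightarrow> ini A p = MInf"
    and fin_support: "\<And>p. p \<notin> states A \<Longrightarrow> fin A p = MInf"
    and all_accessible: "\<And>q. q \<in> states A \<Longrightarrow> accessible A q"
    and all_co_accessible: "\<And>q. q \<in> states A \<Longrightarrow> co_accessible A q"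

definition deterministic :: "('q, 'a) automaton \<Rightarrow> bool" where
  "deterministic A \<longleftrightarrow>
     card {p \<in> states A. ini A p \<noteq> MInf} \<le> 1 \<and>
     (\<forall>a\<in>alphabet A. \<forall>p\<in>states A. card {q \<in> states A. mat A a p q \<noteq> MInf} \<le> 1)"

definition sem :: "('q, 'a) automaton \<Rightarrow> 'a list \<Rightarrow> nmax" where
  "sem A w = vec_mult (states A)
     (foldl (\<lambda>v a. vec_mat_mult (states A) v (mat A a)) (ini A) w) (fin A)"

definition big_O :: "('p, 'a) automaton \<Rightarrow> ('q, 'a) automaton \<Rightarrow> bool" where
  "big_O A B \<longleftrightarrow>
     (\<exists>c>0. \<forall>w\<in>lists (alphabet A). sem A w \<le> scale c (sem B w) + Fin c)"


section \<open>The semigroups\<close>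

text \<open>
  In the following definitions \<open>Q\<close> is the index set of the matrices, to be
  instantiated with the set of states of the second automaton.
\<close>

definition bar_mat :: "('q, omega) matr \<Rightarrow> ('q, omega) matr" where
  "bar_mat M = (\<lambda>p q. obar (M p q))"

definition path_idempotent_mat :: "'q set \<Rightarrow> ('q, omega) matr \<Rightarrow> bool" where
  "path_idempotent_mat Q M \<longleftrightarrow> mat_mult Q (bar_mat M) (bar_mat M) = bar_mat M"

definition sharp_mat :: "'q set \<Rightarrow> ('q, omega) matr \<Rightarrow> ('q, omega) matr" where
  "sharp_mat Q M =
     mat_mult Q (mat_mult Q M (\<lambda>p q. if p = q then osharp (M p q) else M p q)) M"

definition bar_off_diagonal :: "('q, omega) matr \<Rightarrow> ('q, omega) matr" where
  "bar_off_diagonal N = (\<lambda>p q. if p = q then N p q else obar (N p q))"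

definition flat_mat :: "'q set \<Rightarrow> ('q, omega) matr \<Rightarrow> ('q, omega) matr" where
  "flat_mat Q M =
     mat_mult Q (mat_mult Q (bar_mat M) (bar_off_diagonal (mat_mult Q (mat_mult Q M M) M))) (bar_mat M)"

datatype ('p, 'q) elem = Bot | Tup 'p omega 'p "('q, omega) matr"

fun elem_mult :: "'q set \<Rightarrow> ('p, 'q) elem \<Rightarrow> ('p, 'q) elem \<Rightarrow> ('p, 'q) elem" where
  "elem_mult Q (Tup p x q M) (Tup p' x' q' M') =
     (if q = p' then Tup p (x + x') q' (mat_mult Q M M') else Bot)"
| "elem_mult Q _ _ = Bot"

fun path_idempotent :: "'q set \<Rightarrow> ('p, 'q) elem \<Rightarrow> bool" where
  "path_idempotent Q (Tup p x q M) \<longleftrightarrow> p = q \<and> path_idempotent_mat Q M"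
| "path_idempotent Q Bot \<longleftrightarrow> False"

text \<open>
  Stabilisation and flattening are meaningful on path-idempotent elements only, and are
  only ever applied to these.
\<close>

fun sharp :: "'q set \<Rightarrow> ('p, 'q) elem \<Rightarrow> ('p, 'q) elem" where
  "sharp Q (Tup p x q M) = Tup p (osharp x) q (sharp_mat Q M)"
| "sharp Q Bot = Bot"

fun flat :: "'q set \<Rightarrow> ('p, 'q) elem \<Rightarrow> ('p, 'q) elem" where
  "flat Q (Tup p x q M) = Tup p x q (flat_mat Q M)"
| "flat Q Bot = Bot"

definition gens :: "('p, 'a) automaton \<Rightarrow> ('q, 'a) automaton \<Rightarrow> ('p, 'q) elem set" where
  "gens A B = {Tup p (nbar (mat A a p q)) q (\<lambda>r s. nbar (mat B a r s)) | a p q.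
     a \<in> alphabet A \<and> p \<in> states A \<and> q \<in> states A \<and> mat A a p q \<noteq> MInf}"

inductive_set bar_semigroup :: "('p, 'a) automaton \<Rightarrow> ('q, 'a) automaton \<Rightarrow> ('p, 'q) elem set"
  for A :: "('p, 'a) automaton" and B :: "('q, 'a) automaton" where
  gen: "g \<in> gens A B \<Longrightarrow> g \<in> bar_semigroup A B"
| mult: "g \<in> bar_semigroup A B \<Longrightarrow> h \<in> bar_semigroup A B \<Longrightarrow>
    elem_mult (states B) g h \<in> bar_semigroup A B"

inductive_set full_semigroup :: "('p, 'a) automaton \<Rightarrow> ('q, 'a) automaton \<Rightarrow> ('p, 'q) elem set"
  for A :: "('p, 'a) automaton" and B :: "('q, 'a) automaton" where
  gen: "g \<in> gens A B \<Longrightarrow> g \<in> full_semigroup A B"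
| mult: "g \<in> full_semigroup A B \<Longrightarrow> h \<in> full_semigroup A B \<Longrightarrow>
    elem_mult (states B) g h \<in> full_semigroup A B"
| stab: "g \<in> full_semigroup A B \<Longrightarrow> path_idempotent (states B) g \<Longrightarrow>
    sharp (states B) g \<in> full_semigroup A B"
| flatten: "g \<in> full_semigroup A B \<Longrightarrow> path_idempotent (states B) g \<Longrightarrow>
    flat (states B) g \<in> full_semigroup A B"


section \<open>Witnesses of non-domination\<close>

definition witness :: "('p, 'a) automaton \<Rightarrow> ('q, 'a) automaton \<Rightarrow> ('p, 'q) elem \<Rightarrow> bool" where
  "witness A B g \<longleftrightarrow> g \<in> full_semigroup A B \<and>
     (\<exists>p q M. g = Tup p OInf q M \<and> initial A p \<and> final A q \<and>
        vec_mult (states B) (vec_mat_mult (states B) (\<lambda>r. nbar (ini B r)) M)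
          (\<lambda>r. nbar (fin B r)) < OInf)"

text \<open>Adjoining an identity element, represented by \<^term>\<open>None\<close>.\<close>

fun id_mult :: "'q set \<Rightarrow> ('p, 'q) elem option \<Rightarrow> ('p, 'q) elem option \<Rightarrow> ('p, 'q) elem option" where
  "id_mult Q None h = h"
| "id_mult Q g None = g"
| "id_mult Q (Some g) (Some h) = Some (elem_mult Q g h)"

definition bar_monoid :: "('p, 'a) automaton \<Rightarrow> ('q, 'a) automaton \<Rightarrow> ('p, 'q) elem option set" where
  "bar_monoid A B = insert None (Some ` bar_semigroup A B)"

text \<open>
  \<open>nested A B k h\<close> states that \<open>h\<close> is the value of an expression
  \<open>g\<^sub>0 (g\<^sub>1 (\<dots> (g\<^sub>k\<^sub>-\<^sub>1 (g\<^sub>k)\<^sup>\<sharp> g'\<^sub>k\<^sub>-\<^sub>1)\<^sup>\<flat> \<dots>)\<^sup>\<flat> g'\<^sub>1)\<^sup>\<flat> g'\<^sub>0\<close> with \<open>k \<ge> 1\<close>, one \<open>\<sharp>\<close> and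
  \<open>k - 1\<close> nested \<open>\<flat>\<close>. The element \<open>g\<^sub>k\<close> is not the identity, as path-idempotency is defined
  for tuples only.
\<close>

inductive nested ::
  "('p, 'a) automaton \<Rightarrow> ('q, 'a) automaton \<Rightarrow> nat \<Rightarrow> ('p, 'q) elem option \<Rightarrow> bool"
  for A :: "('p, 'a) automaton" and B :: "('q, 'a) automaton" where
  innermost: "e \<in> bar_semigroup A B \<Longrightarrow> path_idempotent (states B) e \<Longrightarrow>
    g \<in> bar_monoid A B \<Longrightarrow> g' \<in> bar_monoid A B \<Longrightarrow>
    nested A B 1 (id_mult (states B) (id_mult (states B) g (Some (sharp (states B) e))) g')"
| outer: "nested A B k (Some e) \<Longrightarrow> path_idempotent (states B) e \<Longrightarrow>
    g \<in> bar_monoid A B \<Longrightarrow> g' \<in> bar_monoid A B \<Longrightarrow>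
    nested A B (Suc k) (id_mult (states B) (id_mult (states B) g (Some (flat (states B) e))) g')"

definition tractable_witness ::
  "('p, 'a) automaton \<Rightarrow> ('q, 'a) automaton \<Rightarrow> ('p, 'q) elem \<Rightarrow> bool" where
  "tractable_witness A B h \<longleftrightarrow> witness A B h \<and>
     (\<exists>k \<le> 3 * card (bar_semigroup A B). nested A B k (Some h))"

end

theory Submission
  imports Defs
begin

text \<open>
  A witness describes a family of words on which the first automaton outgrows the second one:
  stabilisation of an element whose weight is \<open>1\<close> stands for iterating a word, and flattening for
  iterating it so often that the infinite entries not lying on a loop of the second automaton
  become negligible.

  Conversely, every run of the first automaton has a factorisation forest over the barred semigroup
  whose height is bounded and whose idempotent nodes are nested at most \<open>|S| + 1\<close> deep, where \<open>S\<close> is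
  that semigroup. By induction on the forest, either the weight of the run is bounded, or some nested
  expression has infinite entries only where the second automaton has a weight that is at least a
  constant fraction of the weight of the run. At an idempotent node the weight comes from one of the
  outer factors, from the number of factors (stabilise), or from all inner factors sharing one
  nested expression (flatten that expression). If the final expression is not a witness, then one of
  its infinite entries bounds the value of the second automaton from below.
\<close>

section \<open>Max-plus matrices\<close>

text \<open>The bound on the number of flattenings forces the forest to be measured twice. Its
  height only enters the multiplicative constant, whereas the nesting depth of its idempotent nodes
  is what the length of a nested expression must not exceed. Binary nodes cost no depth, because
  multiplying a nested expression by barred elements only changes its outermost factors.
  Stabilisation and flattening keep the barred matrix, so the forest can be built in the finite
  barred semigroup with an identity adjoined; the identity accounts for the \<open>+ 1\<close>. The
  constants come from one principle: if an expression handles a part of the weight with constant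
  \<open>C\<close> but fails to handle the whole weight with a larger constant \<open>C'\<close>,
  then that part is at most the fraction \<open>C / C'\<close> of the whole. A node splits the
  weight into a number of parts that is bounded in terms of \<open>B\<close> alone, since there are
  finitely many candidate matrices. If \<open>C'\<close> is a large enough multiple of
  \<open>C\<close>, the parts cannot add up to the whole unless the weight is bounded.\<close>

class maxplus_semiring = linorder + order_bot + ordered_comm_monoid_add +
  assumes add_eq_bot_iff [simp]: "x + y = bot \<longleftrightarrow> x = bot \<or> y = bot"

lemma bot_nmax [simp]: "(bot :: nmax) = MInf" by (simp add: bot_nmax_def)
lemma bot_omega [simp]: "(bot :: omega) = OMInf" by (simp add: bot_omega_def)

instance nmax :: maxplus_semiring
proof
  fix x y :: nmax
  show "x + y = bot \<longleftrightarrow> x = bot \<or> y = bot" by (cases x; cases y) auto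
qed

instance omega :: maxplus_semiring
proof
  fix x y :: omega
  show "x + y = bot \<longleftrightarrow> x = bot \<or> y = bot" by (cases x; cases y) auto
qed

lemma le_bigmax: "finite Q \<Longrightarrow> q \<in> Q \<Longrightarrow> f q \<le> bigmax Q f"
  unfolding bigmax_def by (rule Max_ge) auto

lemma bigmax_le_iff: "finite Q \<Longrightarrow> bigmax Q f \<le> y \<longleftrightarrow> (\<forall>q\<in>Q. f q \<le> y)"
  unfolding bigmax_def by (subst Max_le_iff) auto

lemma bigmax_cases:
  assumes "finite Q"
  obtains "bigmax Q f = bot" | q where "q \<in> Q" "bigmax Q f = f q"
proof -
  have "bigmax Q f \<in> insert bot (f ` Q)" unfolding bigmax_def using assms by (intro Max_in) auto
  then show thesis using that by auto
qed

text \<open>Distributivity in the form of upper bounds, which \<open>simp\<close> can push through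
  nested maxima. The empty maximum is covered because \<open>add_eq_bot_iff\<close> makes
  \<open>bot\<close> absorbing.\<close>

lemma bigmax_add_le_iff:
  fixes f :: "'q \<Rightarrow> 'x::maxplus_semiring"
  assumes "finite Q"
  shows "bigmax Q f + k \<le> y \<longleftrightarrow> (\<forall>q\<in>Q. f q + k \<le> y)" (is "?L \<longleftrightarrow> ?R")
proof
  assume ?L
  then show ?R using le_bigmax[OF assms, of _ f] by (meson add_right_mono order_trans)
next
  have [simp]: "bot + k = bot" by simp
  assume ?R
  then show ?L by (cases rule: bigmax_cases[OF assms, of f]) auto
qed

lemma add_bigmax_le_iff:
  fixes f :: "'q \<Rightarrow> 'x::maxplus_semiring"
  assumes "finite Q"
  shows "k + bigmax Q f \<le> y \<longleftrightarrow> (\<forall>q\<in>Q. k + f q \<le> y)"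
  using bigmax_add_le_iff[OF assms, of f k y] by (simp add: add.commute)

text \<open>In a linear order an element is determined by its upper bounds, and \<open>y\<close>
  bounds either side exactly if it bounds every sum \<open>L p r + M r s + N s q\<close>.\<close>

lemma mat_mult_assoc:
  fixes L :: "('q, 'x::maxplus_semiring) matr"
  assumes "finite Q"
  shows "mat_mult Q (mat_mult Q L M) N = mat_mult Q L (mat_mult Q M N)"
proof (intro ext)
  fix p q
  have "mat_mult Q (mat_mult Q L M) N p q \<le> y \<longleftrightarrow> mat_mult Q L (mat_mult Q M N) p q \<le> y" for y
    unfolding mat_mult_def
    by (simp add: bigmax_le_iff bigmax_add_le_iff add_bigmax_le_iff assms add.assoc) blast
  then show "mat_mult Q (mat_mult Q L M) N p q = mat_mult Q L (mat_mult Q M N) p q"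
    by (meson order_antisym order_refl)
qed

lemma vec_mat_mult_assoc:
  fixes v :: "'q \<Rightarrow> 'x::maxplus_semiring"
  assumes "finite Q"
  shows "vec_mat_mult Q (vec_mat_mult Q v M) N = vec_mat_mult Q v (mat_mult Q M N)"
proof (intro ext)
  fix q
  have "vec_mat_mult Q (vec_mat_mult Q v M) N q \<le> y \<longleftrightarrow> vec_mat_mult Q v (mat_mult Q M N) q \<le> y" for y
    unfolding mat_mult_def vec_mat_mult_def
    by (simp add: bigmax_le_iff bigmax_add_le_iff add_bigmax_le_iff assms add.assoc) blast
  then show "vec_mat_mult Q (vec_mat_mult Q v M) N q = vec_mat_mult Q v (mat_mult Q M N) q"
    by (meson order_antisym order_refl)
qed

lemma vec_mult_le_iff:
  fixes v :: "'q \<Rightarrow> 'x::maxplus_semiring"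
  assumes "finite Q"
  shows "vec_mult Q (vec_mat_mult Q v M) u \<le> y \<longleftrightarrow> (\<forall>p\<in>Q. \<forall>q\<in>Q. v p + M p q + u q \<le> y)"
  unfolding vec_mult_def vec_mat_mult_def by (auto simp: bigmax_le_iff bigmax_add_le_iff assms)

lemma vec_mult_ge:
  fixes v :: "'q \<Rightarrow> 'x::maxplus_semiring"
  assumes "finite Q" "p \<in> Q" "q \<in> Q"
  shows "v p + M p q + u q \<le> vec_mult Q (vec_mat_mult Q v M) u"
  using vec_mult_le_iff[OF assms(1), of v M u "vec_mult Q (vec_mat_mult Q v M) u"] assms by simp

lemma vec_mult_cases:
  fixes v :: "'q \<Rightarrow> 'x::maxplus_semiring"
  assumes "finite Q"
  obtains "vec_mult Q (vec_mat_mult Q v M) u = bot"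
  | p q where "p \<in> Q" "q \<in> Q" "vec_mult Q (vec_mat_mult Q v M) u = v p + M p q + u q"
proof (cases rule: bigmax_cases[OF assms, of "\<lambda>q. vec_mat_mult Q v M q + u q"])
  case 1
  then show thesis using that(1) by (simp add: vec_mult_def)
next
  case (2 q)
  show thesis
  proof (cases rule: bigmax_cases[OF assms, of "\<lambda>p. v p + M p q"])
    case 1
    then have "vec_mult Q (vec_mat_mult Q v M) u = bot + u q"
      using 2 by (simp add: vec_mult_def vec_mat_mult_def)
    then show thesis using that(1) by simp
  next
    case (2 p)
    then show thesis
      using that(2) \<open>q \<in> Q\<close> \<open>bigmax Q (\<lambda>q. vec_mat_mult Q v M q + u q) = vec_mat_mult Q v M q + u q\<close>
      by (simp add: vec_mult_def vec_mat_mult_def)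
  qed
qed

lemma mat_mult_ge: "finite Q \<Longrightarrow> r \<in> Q \<Longrightarrow> M p r + N r q \<le> mat_mult Q M N p q"
  unfolding mat_mult_def by (rule le_bigmax)

lemma mat_mult_cases:
  assumes "finite Q"
  obtains "mat_mult Q M N p q = bot" | r where "r \<in> Q" "mat_mult Q M N p q = M p r + N r q"
  unfolding mat_mult_def by (rule bigmax_cases[OF assms])

lemma mat_mult_eq_bot_iff:
  fixes M :: "('q, 'x::maxplus_semiring) matr"
  assumes "finite Q"
  shows "mat_mult Q M N p q = bot \<longleftrightarrow> (\<forall>r\<in>Q. M p r = bot \<or> N r q = bot)"
proof
  assume "mat_mult Q M N p q = bot"
  then show "\<forall>r\<in>Q. M p r = bot \<or> N r q = bot"
    using mat_mult_ge[OF assms, of _ M p N q] by (metis add_eq_bot_iff bot.extremum_unique)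
next
  assume "\<forall>r\<in>Q. M p r = bot \<or> N r q = bot"
  then show "mat_mult Q M N p q = bot" by (cases rule: mat_mult_cases[OF assms, of M N p q]) auto
qed

text \<open>In a linear order monotone maps commute with finite nonempty maxima; sending
  \<open>bot\<close> to \<open>bot\<close> covers the empty one.\<close>

lemma mat_mult_hom:
  assumes "finite Q" "mono h" "h bot = bot" "\<And>x y. h (x + y) = h x + h y"
  shows "h (mat_mult Q M N p q) = mat_mult Q (\<lambda>p q. h (M p q)) (\<lambda>p q. h (N p q)) p q"
proof (rule order_antisym)
  show "h (mat_mult Q M N p q) \<le> mat_mult Q (\<lambda>p q. h (M p q)) (\<lambda>p q. h (N p q)) p q"
    using mat_mult_ge[OF assms(1), of _ "\<lambda>p q. h (M p q)" p "\<lambda>p q. h (N p q)" q]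
    by (cases rule: mat_mult_cases[OF assms(1), of M N p q]) (auto simp: assms)
  have "h (M p r) + h (N r q) \<le> h (mat_mult Q M N p q)" if "r \<in> Q" for r
    using monoD[OF assms(2) mat_mult_ge[OF assms(1) that, of M p N q]] by (simp add: assms)
  then show "mat_mult Q (\<lambda>p q. h (M p q)) (\<lambda>p q. h (N p q)) p q \<le> h (mat_mult Q M N p q)"
    by (cases rule: mat_mult_cases[OF assms(1), of "\<lambda>p q. h (M p q)" "\<lambda>p q. h (N p q)" p q]) auto
qed

section \<open>The bar maps as semiring homomorphisms\<close>

lemma nbar_add: "nbar (x + y) = nbar x + nbar y"
  by (cases x; cases y) auto

lemma mono_nbar: "mono nbar"
proof
  fix x y :: nmax show "x \<le> y \<Longrightarrow> nbar x \<le> nbar y"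
    by (cases x; cases y) (auto simp: less_eq_omega_def)
qed

lemma obar_add: "obar (x + y) = obar x + obar y"
  by (cases x; cases y) auto

lemma mono_obar: "mono obar"
proof
  fix x y show "x \<le> y \<Longrightarrow> obar x \<le> obar y"
    by (cases x; cases y) (auto simp: less_eq_omega_def)
qed

lemma nbar_mat_mult:
  "finite Q \<Longrightarrow> (\<lambda>p q. nbar (mat_mult Q M N p q)) = mat_mult Q (\<lambda>p q. nbar (M p q)) (\<lambda>p q. nbar (N p q))"
  by (intro ext mat_mult_hom) (auto simp: mono_nbar nbar_add)

lemma bar_mat_mult: "finite Q \<Longrightarrow> bar_mat (mat_mult Q M N) = mat_mult Q (bar_mat M) (bar_mat N)"
  unfolding bar_mat_def by (intro ext mat_mult_hom) (auto simp: mono_obar obar_add)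

lemma obar_simps [simp]: "obar (obar x) = obar x" "obar x = OMInf \<longleftrightarrow> x = OMInf" "obar (osharp x) = obar x"
   "obar (nbar y) = nbar y" "obar x \<noteq> OInf" "nbar y \<noteq> OInf" "nbar y = OMInf \<longleftrightarrow> y = MInf"
   "nbar y = OZero \<longleftrightarrow> y = Fin 0"
  by (cases x; cases y; auto)+

lemma bar_bar_mat [simp]: "bar_mat (bar_mat M) = bar_mat M"
  by (simp add: bar_mat_def)

lemma bar_bar_off_diagonal [simp]: "bar_mat (bar_off_diagonal M) = bar_mat M"
  by (auto simp: fun_eq_iff bar_mat_def bar_off_diagonal_def)

text \<open>The bar does not see the difference between a diagonal entry and its stabilisation, so
  the three factors become the same idempotent.\<close>

lemma bar_sharp_mat:
  assumes "finite Q" "path_idempotent_mat Q M"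
  shows "bar_mat (sharp_mat Q M) = bar_mat M"
proof -
  have "bar_mat (\<lambda>p q. if p = q then osharp (M p q) else M p q) = bar_mat M"
    by (auto simp: fun_eq_iff bar_mat_def)
  then show ?thesis using assms by (simp add: sharp_mat_def bar_mat_mult path_idempotent_mat_def)
qed

lemma bar_flat_mat:
  assumes "finite Q" "path_idempotent_mat Q M"
  shows "bar_mat (flat_mat Q M) = bar_mat M"
  using assms by (simp add: flat_mat_def bar_mat_mult path_idempotent_mat_def)

lemma omega_le_OInf [simp]: "x \<le> OInf" and omega_ge_OInf [simp]: "OInf \<le> x \<longleftrightarrow> x = OInf"
  by (cases x; simp add: less_eq_omega_def)+

lemma add_eq_OInf_iff:
  "x + y = OInf \<longleftrightarrow> (x = OInf \<and> y \<noteq> OMInf) \<or> (y = OInf \<and> x \<noteq> OMInf)"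
  by (cases x; cases y) auto

lemma mat_mult_eq_OInf_iff:
  assumes "finite Q"
  shows "mat_mult Q M N p q = OInf \<longleftrightarrow> (\<exists>r\<in>Q. M p r + N r q = OInf)"
proof
  assume "mat_mult Q M N p q = OInf"
  then show "\<exists>r\<in>Q. M p r + N r q = OInf"
    by (cases rule: mat_mult_cases[OF assms, of M N p q]) auto
next
  assume "\<exists>r\<in>Q. M p r + N r q = OInf"
  then show "mat_mult Q M N p q = OInf" using mat_mult_ge[OF assms] by (metis omega_ge_OInf)
qed

lemma elem_mult_assoc:
  "finite Q \<Longrightarrow> elem_mult Q (elem_mult Q g h) k = elem_mult Q g (elem_mult Q h k)"
  by (cases g; cases h; cases k) (auto simp: mat_mult_assoc add.assoc)

lemma id_mult_None_right [simp]: "id_mult Q g None = g"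
  by (cases g) auto

lemma id_mult_assoc:
  "finite Q \<Longrightarrow> id_mult Q (id_mult Q g h) k = id_mult Q g (id_mult Q h k)"
  by (cases g; cases h; cases k) (auto simp: elem_mult_assoc)

section \<open>Word matrices of an automaton\<close>

fun word_mat :: "('q, 'a) automaton \<Rightarrow> 'a list \<Rightarrow> ('q, nmax) matr" where
  "word_mat A [] = (\<lambda>p q. if p = q \<and> p \<in> states A then Fin 0 else MInf)"
| "word_mat A (a # w) = mat_mult (states A) (mat A a) (word_mat A w)"

lemma Fin0_add [simp]: "Fin 0 + x = x" "x + Fin 0 = x"
  by (cases x; simp)+

lemma add_MInf [simp]: "x + MInf = MInf"
  by (cases x) auto

context max_plus_automaton
begin

lemma word_mat_support:
  assumes "w \<in> lists (alphabet A)" "p \<notin> states A \<or> q \<notin> states A"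
  shows "word_mat A w p q = MInf"
  using assms
proof (induction w arbitrary: p)
  case (Cons a w)
  then have "mat_mult (states A) (mat A a) (word_mat A w) p q = bot"
    unfolding mat_mult_eq_bot_iff[OF finite_states] using mat_support by auto
  then show ?case by simp
qed auto

lemma word_mat_append:
  assumes "u \<in> lists (alphabet A)" "v \<in> lists (alphabet A)"
  shows "word_mat A (u @ v) = mat_mult (states A) (word_mat A u) (word_mat A v)"
  using assms(1)
proof (induction u)
  case Nil
  show ?case
  proof (intro ext)
    fix p q
    \<comment> \<open>\<open>word_mat A []\<close> is an identity on \<open>states A\<close> only;
      outside, both sides are \<open>MInf\<close> by the support condition.\<close>
    have "mat_mult (states A) (word_mat A []) (word_mat A v) p q \<le> y \<longleftrightarrow> word_mat A v p q \<le> y" for y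
      using word_mat_support[OF assms(2), of p q]
      by (auto simp: mat_mult_def bigmax_le_iff finite_states)
    then show "word_mat A ([] @ v) p q = mat_mult (states A) (word_mat A []) (word_mat A v) p q"
      by (metis append_Nil order_antisym order_refl)
  qed
next
  case (Cons a u)
  then show ?case by (auto simp: mat_mult_assoc finite_states)
qed

lemma sem_eq:
  assumes "w \<in> lists (alphabet A)"
  shows "sem A w = vec_mult (states A) (vec_mat_mult (states A) (ini A) (word_mat A w)) (fin A)"
proof -
  have "foldl (\<lambda>v a. vec_mat_mult (states A) v (mat A a)) v w = vec_mat_mult (states A) v (word_mat A w)"
    if "\<And>p. p \<notin> states A \<Longrightarrow> v p = MInf" for v
    using assms that
  proof (induction w arbitrary: v)
    case Nil
    show ?case
    proof
      fix q
      have "vec_mat_mult (states A) v (word_mat A []) q \<le> y \<longleftrightarrow> v q \<le> y" for y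
        using Nil(1)[of q] by (auto simp: vec_mat_mult_def bigmax_le_iff finite_states)
      then show "foldl (\<lambda>v a. vec_mat_mult (states A) v (mat A a)) v [] q = vec_mat_mult (states A) v (word_mat A []) q"
        by (metis foldl_Nil order_antisym order_refl)
    qed
  next
    case (Cons a w)
    have "vec_mat_mult (states A) v (mat A a) p = MInf" if "p \<notin> states A" for p
      using that Cons(1) mat_support[of a _ p]
      by (cases rule: bigmax_cases[OF finite_states, of "\<lambda>q. v q + mat A a q p"]) (auto simp: vec_mat_mult_def)
    then show ?case using Cons by (auto simp: vec_mat_mult_assoc finite_states)
  qed
  then show ?thesis unfolding sem_def using ini_support by simp
qed

lemma word_mat_append_ge:
  assumes "u \<in> lists (alphabet A)" "v \<in> lists (alphabet A)"
  shows "word_mat A u p r + word_mat A v r q \<le> word_mat A (u @ v) p q"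
proof (cases "r \<in> states A")
  case True
  then show ?thesis unfolding word_mat_append[OF assms] by (rule mat_mult_ge[OF finite_states])
next
  case False
  then show ?thesis using word_mat_support[OF assms(1)] by simp
qed

lemma word_mat_append_Fin:
  assumes "u \<in> lists (alphabet A)" "v \<in> lists (alphabet A)" "word_mat A (u @ v) p q = Fin b"
  obtains r b1 b2 where "r \<in> states A" "word_mat A u p r = Fin b1" "word_mat A v r q = Fin b2" "b = b1 + b2"
proof -
  have eq: "mat_mult (states A) (word_mat A u) (word_mat A v) p q = Fin b"
    using assms(3) word_mat_append[OF assms(1,2)] by simp
  show thesis
  proof (cases rule: mat_mult_cases[OF finite_states, of "word_mat A u" "word_mat A v" p q])
    case 1
    then show thesis using eq by simp
  next
    case (2 r)
    then show thesis using that[of r] eq by (cases "word_mat A u p r"; cases "word_mat A v r q") auto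
  qed
qed

lemma word_mat_bounded:
  assumes "w \<in> lists (alphabet A)"
  obtains K where "\<And>p q b. word_mat A w p q = Fin b \<Longrightarrow> b \<le> K"
proof -
  let ?S = "(\<lambda>(p, q). word_mat A w p q) ` (states A \<times> states A)"
  have "finite (Fin -` ?S)" using finite_states by (intro finite_vimageI) (auto simp: inj_def)
  then obtain K where "\<forall>b\<in>Fin -` ?S. b \<le> K" by (meson finite_nat_set_iff_bounded_le)
  then have "b \<le> K" if "word_mat A w p q = Fin b" for p q b
    using that word_mat_support[OF assms, of p q] by force
  then show thesis using that by blast
qed

text \<open>A step from \<open>u\<close> to \<open>v\<close> that lies on no loop strictly decreases the set of the states that are
  reachable, so there are boundedly many such steps.\<close>

lemma power_bound:
  fixes w bad
  defines "e r s \<equiv> word_mat A w r s \<noteq> MInf"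
  assumes w: "w \<in> lists (alphabet A)"
    and e_trans: "\<And>r s t. e r s \<Longrightarrow> e s t \<Longrightarrow> e r t"
    and K: "\<And>u v b. word_mat A w u v = Fin b \<Longrightarrow> b \<le> K"
    and good: "\<And>u v b. word_mat A w u v = Fin b \<Longrightarrow> \<not> bad u v \<Longrightarrow> n * b \<le> G"
    and loop: "\<And>u v. bad u v \<Longrightarrow> e u v \<Longrightarrow> r = u \<or> e r u \<Longrightarrow> v = s \<or> e v s \<Longrightarrow> u = v \<or> e v u \<Longrightarrow> False"
    and b: "word_mat A (concat (replicate m w)) r s = Fin b"
  shows "n * b \<le> m * G + n * K * (Suc (card (states A)))"
proof -
  \<comment> \<open>The potential: as \<open>e\<close> is transitive, \<open>R\<close> can only
    shrink along a step. It contains \<open>r\<close> itself, which need not be a state, hence the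
    \<open>Suc\<close> in the bound.\<close>
  define R where "R r = {t. r = t \<or> e r t}" for r
  have sub: "R r \<subseteq> insert r (states A)" for r
    using word_mat_support[OF w] by (auto simp: R_def e_def)
  have fin: "finite (R r)" for r using sub finite_states by (meson finite_insert finite_subset)
  have wm: "concat (replicate m w) \<in> lists (alphabet A)" for m using w by (induction m) auto
  have pow: "r = s \<or> e r s" if "word_mat A (concat (replicate m w)) r s \<noteq> MInf" for m r s
    using that
  proof (induction m arbitrary: r)
    case 0
    then show ?case by (auto split: if_splits)
  next
    case (Suc m)
    then obtain b where "word_mat A (w @ concat (replicate m w)) r s = Fin b"
      by (cases "word_mat A (w @ concat (replicate m w)) r s") auto
    then obtain t b1 b2 where "word_mat A w r t = Fin b1" "word_mat A (concat (replicate m w)) t s = Fin b2"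
      using word_mat_append_Fin[OF w wm] by metis
    then show ?case using Suc.IH[of t] e_trans[of r t s] by (auto simp: e_def)
  qed
  \<comment> \<open>A good step is charged to \<open>m * G\<close>; a bad one costs at most
    \<open>n * K\<close> and lowers the potential.\<close>
  have "n * b \<le> m * G + n * K * card (R r)"
    using loop b
  proof (induction m arbitrary: r b)
    case 0
    then show ?case by (auto split: if_splits)
  next
    case (Suc m)
    obtain t b1 b2 where t: "word_mat A w r t = Fin b1" "b = b1 + b2"
      "word_mat A (concat (replicate m w)) t s = Fin b2"
      using word_mat_append_Fin[OF w wm] Suc.prems(2) by (metis concat.simps(2) replicate_Suc)
    have ert: "e r t" using t by (simp add: e_def)
    have R: "R t \<subseteq> R r" using ert e_trans by (auto simp: R_def)
    have IH: "n * b2 \<le> m * G + n * K * card (R t)"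
    proof (rule Suc.IH)
      fix u v assume "bad u v" "e u v" "t = u \<or> e t u" "v = s \<or> e v s" "u = v \<or> e v u"
      then show False using Suc.prems(1)[of u v] ert e_trans by blast
    qed (rule t)
    show ?case
    proof (cases "bad r t")
      case False
      have "n * b1 \<le> G" using good t False by blast
      moreover have "n * K * card (R t) \<le> n * K * card (R r)"
        using R fin by (simp add: card_mono)
      moreover have "n * b = n * b1 + n * b2" "Suc m * G = G + m * G"
        using t(2) by (simp_all add: distrib_left)
      ultimately show ?thesis using IH by linarith
    next
      case True
      have "t = s \<or> e t s" using pow[of m t s] t(3) by simp
      \<comment> \<open>Otherwise the bad step from \<open>r\<close> to \<open>t\<close> could be
        undone and would lie on a loop between \<open>r\<close> and \<open>s\<close>.\<close>
      then have "r \<notin> R t" using Suc.prems(1)[OF True ert] by (auto simp: R_def)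
      then have "R t \<subset> R r" using R by (auto simp: R_def)
      then have "Suc (card (R t)) \<le> card (R r)" using fin by (simp add: psubset_card_mono Suc_le_eq)
      then have "n * K * Suc (card (R t)) \<le> n * K * card (R r)" by (rule mult_le_mono2)
      moreover have "n * b1 \<le> n * K" using K[OF t(1)] by simp
      moreover have "n * b = n * b1 + n * b2" "Suc m * G = G + m * G"
          "n * K * Suc (card (R t)) = n * K + n * K * card (R t)"
        using t(2) by (simp_all add: distrib_left)
      ultimately show ?thesis using IH by linarith
    qed
  qed
  moreover have "card (R r) \<le> Suc (card (states A))"
    using card_mono[OF _ sub[of r]] finite_states by (simp add: card_insert_if split: if_splits)
  then have "n * K * card (R r) \<le> n * K * Suc (card (states A))" by (rule mult_le_mono2)
  ultimately show ?thesis by linarith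
qed

lemma word_mat_power_ge:
  assumes "w \<in> lists (alphabet A)" "Fin a \<le> word_mat A w p p" "p \<in> states A"
  shows "Fin (m * a) \<le> word_mat A (concat (replicate m w)) p p"
proof (induction m)
  case 0
  then show ?case using assms by simp
next
  case (Suc m)
  have "concat (replicate m w) \<in> lists (alphabet A)" using assms(1) by (induction m) auto
  then have "word_mat A w p p + word_mat A (concat (replicate m w)) p p
      \<le> word_mat A (concat (replicate (Suc m) w)) p p"
    using word_mat_append_ge[OF assms(1)] by simp
  moreover have "Fin a + Fin (m * a) \<le> word_mat A w p p + word_mat A (concat (replicate m w)) p p"
    using Suc assms by (intro add_mono)
  ultimately have "Fin a + Fin (m * a) \<le> word_mat A (concat (replicate (Suc m) w)) p p"
    by (rule order_trans[rotated])
  then show ?case by simp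
qed

end

section \<open>Factorisation forests\<close>

locale finite_submonoid = monoid f z
  for f :: "'m \<Rightarrow> 'm \<Rightarrow> 'm" (infixl "\<^bold>*" 70) and z :: 'm ("\<^bold>1") +
  fixes M :: "'m set"
  assumes finite_M: "finite M"
    and one_closed [simp, intro]: "\<^bold>1 \<in> M"
    and mult_closed [simp, intro]: "x \<in> M \<Longrightarrow> y \<in> M \<Longrightarrow> x \<^bold>* y \<in> M"
begin

section \<open>Green's relations in a finite monoid\<close>

definition Jle :: "'m \<Rightarrow> 'm \<Rightarrow> bool" (infix "\<preceq>" 50) where
  "x \<preceq> y \<longleftrightarrow> (\<exists>a\<in>M. \<exists>b\<in>M. x = a \<^bold>* y \<^bold>* b)"

lemma Jle_refl [simp]: "x \<preceq> x"
  unfolding Jle_def by (metis left_neutral one_closed right_neutral)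

lemma Jle_trans [trans]: "x \<preceq> y \<Longrightarrow> y \<preceq> w \<Longrightarrow> x \<preceq> w"
  unfolding Jle_def by (metis assoc mult_closed)

lemma Jle_multI1: "y \<in> M \<Longrightarrow> x \<^bold>* y \<preceq> x"
  unfolding Jle_def by (metis left_neutral one_closed)

lemma Jle_multI2: "x \<in> M \<Longrightarrow> x \<^bold>* y \<preceq> y"
  unfolding Jle_def by (metis right_neutral one_closed)

text \<open>Stability of finite monoids. With \<open>x = u x t\<close>, left multiplication by
  \<open>u\<close> maps the right ideal \<open>x t M\<close> onto \<open>x M\<close>; as
  \<open>x t M\<close> is contained in \<open>x M\<close>, counting makes them equal.\<close>

lemma stable_right:
  assumes "x \<in> M" "y \<in> M" "x \<preceq> x \<^bold>* y"
  shows "\<exists>w\<in>M. x = x \<^bold>* y \<^bold>* w"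
proof -
  obtain u v where uv: "u \<in> M" "v \<in> M" "x = u \<^bold>* (x \<^bold>* y) \<^bold>* v"
    using assms(3) unfolding Jle_def by blast
  define t where "t = y \<^bold>* v"
  have t: "t \<in> M" using assms uv by (simp add: t_def)
  have x: "u \<^bold>* (x \<^bold>* t) = x" using uv(3) by (simp add: t_def assoc)
  let ?X = "(\<lambda>m. x \<^bold>* m) ` M" and ?T = "(\<lambda>m. x \<^bold>* t \<^bold>* m) ` M"
  have "(\<lambda>m. u \<^bold>* m) ` ?T = ?X"
    using x by (force simp: image_image assoc[symmetric])
  then have "card ?X \<le> card ?T"
    by (metis card_image_le finite_M finite_imageI)
  moreover have "?T \<subseteq> ?X" using t by (auto simp: assoc)
  ultimately have "?T = ?X" using finite_M by (simp add: card_seteq)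
  moreover have "x \<in> ?X" by (metis image_eqI one_closed right_neutral)
  ultimately obtain m where "m \<in> M" "x = x \<^bold>* t \<^bold>* m" by auto
  then show ?thesis using uv by (intro bexI[of _ "v \<^bold>* m"]) (auto simp: t_def assoc)
qed

lemma stable_left:
  assumes "x \<in> M" "y \<in> M" "x \<preceq> y \<^bold>* x"
  shows "\<exists>w\<in>M. x = w \<^bold>* (y \<^bold>* x)"
proof -
  \<comment> \<open>The opposite monoid has the same J-order, so the right-hand version applies
    there.\<close>
  interpret op: finite_submonoid "\<lambda>a b. b \<^bold>* a" "\<^bold>1" M
    by unfold_locales (auto simp: assoc finite_M)
  obtain u v where "u \<in> M" "v \<in> M" "x = u \<^bold>* (y \<^bold>* x) \<^bold>* v"
    using assms(3) unfolding Jle_def by blast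
  then have "op.Jle x (y \<^bold>* x)"
    unfolding op.Jle_def by (intro bexI[of _ v] bexI[of _ u]) (simp_all add: assoc)
  then show ?thesis using op.stable_right[of x y] assms(1,2) by simp
qed

text \<open>Its cardinality is the induction measure of the forest theorem: an element strictly
  J-above \<open>s\<close> has fewer elements above it than \<open>s\<close> has.\<close>

definition up :: "'m \<Rightarrow> 'm set" where "up s = {x \<in> M. s \<preceq> x}"
definition Jclass :: "'m \<Rightarrow> 'm set" where "Jclass s = {x \<in> M. s \<preceq> x \<and> x \<preceq> s}"
definition Rclass :: "'m \<Rightarrow> 'm set" where "Rclass x = {y \<in> M. (\<exists>w\<in>M. x = y \<^bold>* w) \<and> (\<exists>w\<in>M. y = x \<^bold>* w)}"

lemma Rclass_self: "x \<in> M \<Longrightarrow> x \<in> Rclass x"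
  unfolding Rclass_def by (auto intro!: bexI[of _ "\<^bold>1"])

lemma Rclass_eqI:
  assumes "y \<in> Rclass x" "x \<in> M"
  shows "Rclass y = Rclass x"
proof -
  have *: "Rclass y \<subseteq> Rclass x" if "y \<in> Rclass x" for x y
  proof
    fix u assume "u \<in> Rclass y"
    then obtain a b where ab: "u \<in> M" "a \<in> M" "b \<in> M" "y = u \<^bold>* a" "u = y \<^bold>* b"
      unfolding Rclass_def by blast
    obtain c d where cd: "c \<in> M" "d \<in> M" "x = y \<^bold>* c" "y = x \<^bold>* d"
      using \<open>y \<in> Rclass x\<close> unfolding Rclass_def by blast
    have "x = u \<^bold>* (a \<^bold>* c)" unfolding assoc[symmetric] ab(4)[symmetric] by (rule cd)
    moreover have "u = x \<^bold>* (d \<^bold>* b)" unfolding assoc[symmetric] cd(4)[symmetric] by (rule ab)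
    ultimately show "u \<in> Rclass x" unfolding Rclass_def using ab(1-3) cd(1,2) by blast
  qed
  have "x \<in> Rclass y" using assms unfolding Rclass_def by blast
  then show ?thesis using * assms by blast
qed

lemma Rclass_mult:
  assumes "x \<in> M" "y \<in> M" "x \<preceq> x \<^bold>* y"
  shows "Rclass (x \<^bold>* y) = Rclass x"
proof (rule Rclass_eqI)
  show "x \<^bold>* y \<in> Rclass x"
    unfolding Rclass_def using stable_right[OF assms] assms(1,2) by blast
qed (use assms in auto)

lemma finite_Jclass: "finite (Jclass s)" and finite_up: "finite (up s)"
  using finite_M by (auto simp: Jclass_def up_def)

text \<open>By Green's lemma, the elements of one R-class, paired with the R-classes of its J-class, are
  in bijection with the J-class.\<close>

lemma card_types_le:
  assumes "c \<in> Jclass s"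
    and P: "\<And>g R. (g, R) \<in> P \<Longrightarrow> Rclass g = Rclass c \<and> g \<in> M \<and> (\<exists>x\<in>Jclass s. R = Rclass x)"
  shows "card P \<le> card (Jclass s)"
proof -
  have c: "c \<in> M" "s \<preceq> c" "c \<preceq> s" using assms by (auto simp: Jclass_def)
  \<comment> \<open>Left translation by \<open>t\<close> carries \<open>c\<close> into the R-class
    of \<open>x\<close>, and \<open>t'\<close> carries it back. If \<open>x = a c b\<close>,
    stability on both sides shows that \<open>t = a\<close> works.\<close>
  have ex: "\<exists>t\<in>M. \<exists>t'\<in>M. t' \<^bold>* (t \<^bold>* c) = c \<and> Rclass (t \<^bold>* c) = Rclass x" if "x \<in> Jclass s" for x
  proof -
    have x: "x \<in> M" "s \<preceq> x" "x \<preceq> s" using that by (auto simp: Jclass_def)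
    have "x \<preceq> c" using x c Jle_trans by blast
    then obtain a b where ab: "a \<in> M" "b \<in> M" "x = a \<^bold>* c \<^bold>* b" unfolding Jle_def by blast
    have xc: "c \<preceq> x" using x c Jle_trans by blast
    have le: "x \<preceq> a \<^bold>* c" using ab Jle_multI1 by blast
    have "c \<preceq> a \<^bold>* c" using le xc Jle_trans by blast
    then obtain w where w: "w \<in> M" "c = w \<^bold>* (a \<^bold>* c)" using stable_left c ab by blast
    have "a \<^bold>* c \<preceq> c" using ab Jle_multI2 by blast
    then have "a \<^bold>* c \<preceq> a \<^bold>* c \<^bold>* b" using xc ab Jle_trans by metis
    then have "Rclass x = Rclass (a \<^bold>* c)" using Rclass_mult[of "a \<^bold>* c" b] ab c by auto
    then show ?thesis using w ab(1) by (intro bexI[of _ a] bexI[of _ w]) auto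
  qed
  define t where "t R = (SOME t. t \<in> M \<and> (\<exists>t'\<in>M. t' \<^bold>* (t \<^bold>* c) = c) \<and> Rclass (t \<^bold>* c) = R)" for R
  have t: "t R \<in> M \<and> (\<exists>t'\<in>M. t' \<^bold>* (t R \<^bold>* c) = c) \<and> Rclass (t R \<^bold>* c) = R" if gR: "(g, R) \<in> P" for g R
  proof -
    have "\<exists>t. t \<in> M \<and> (\<exists>t'\<in>M. t' \<^bold>* (t \<^bold>* c) = c) \<and> Rclass (t \<^bold>* c) = R"
    proof -
      obtain x where "x \<in> Jclass s" "R = Rclass x" using P[OF gR] by blast
      then show ?thesis using ex[of x] by blast
    qed
    then show ?thesis unfolding t_def by (rule someI_ex)
  qed
  \<comment> \<open>One translation is fixed per R-class, independently of \<open>g\<close>. The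
    R-class of the image recovers \<open>R\<close>, and the inverse translation then recovers
    \<open>g\<close>.\<close>
  let ?f = "\<lambda>(g, R). t R \<^bold>* g"
  have key: "Rclass (t R \<^bold>* g) = R \<and> t R \<^bold>* g \<in> Jclass s \<and> (\<exists>t'\<in>M. t' \<^bold>* (t R \<^bold>* c) = c \<and> t' \<^bold>* (t R \<^bold>* g) = g)"
    if gR: "(g, R) \<in> P" for g R
  proof -
    obtain t' where t': "t R \<in> M" "t' \<in> M" "t' \<^bold>* (t R \<^bold>* c) = c" "Rclass (t R \<^bold>* c) = R"
      using t[OF gR] by (elim conjE bexE)
    have g: "g \<in> M" "Rclass g = Rclass c" using P[OF gR] by auto
    have "g \<in> Rclass c" using g Rclass_self by blast
    then obtain w w' where w: "w \<in> M" "w' \<in> M" "g = c \<^bold>* w" "c = g \<^bold>* w'" unfolding Rclass_def by blast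
    have "t' \<^bold>* (t R \<^bold>* g) = t' \<^bold>* (t R \<^bold>* c) \<^bold>* w" by (simp only: assoc w(3))
    then have 1: "t' \<^bold>* (t R \<^bold>* g) = g" using t'(3) w(3) by simp
    have "t R \<^bold>* g = t R \<^bold>* c \<^bold>* w" "t R \<^bold>* c = t R \<^bold>* g \<^bold>* w'"
      unfolding assoc w(3)[symmetric] w(4)[symmetric] by (rule refl)+
    then have "t R \<^bold>* g \<in> Rclass (t R \<^bold>* c)"
      unfolding Rclass_def using w(1,2) t'(1) g(1) by blast
    then have 2: "Rclass (t R \<^bold>* g) = R" using t' c Rclass_eqI by blast
    have "g \<preceq> t R \<^bold>* g" using Jle_multI2[of t' "t R \<^bold>* g"] 1 t'(2) by simp
    moreover have "t R \<^bold>* g \<preceq> g" using t' Jle_multI2 by blast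
    moreover have "g \<preceq> c" "c \<preceq> g"
      using Jle_multI1[OF w(1), of c, folded w(3)] Jle_multI1[OF w(2), of g, folded w(4)] .
    ultimately have "s \<preceq> t R \<^bold>* g" "t R \<^bold>* g \<preceq> s" using c(2,3) Jle_trans by blast+
    then have "t R \<^bold>* g \<in> Jclass s" using t'(1) g(1) by (simp add: Jclass_def)
    then show ?thesis using 1 2 t'(2,3) by blast
  qed
  have "inj_on ?f P"
  proof (rule inj_onI, clarify)
    fix g R g' R' assume *: "(g, R) \<in> P" "(g', R') \<in> P" "t R \<^bold>* g = t R' \<^bold>* g'"
    have R: "R = R'" using key[OF *(1), THEN conjunct1] key[OF *(2), THEN conjunct1] *(3) by simp
    obtain t' where t': "t' \<in> M" "t' \<^bold>* (t R \<^bold>* c) = c" "t' \<^bold>* (t R \<^bold>* g) = g"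
      using key[OF *(1)] by (elim conjE bexE)
    have "g' \<in> Rclass c" using P[OF *(2)] Rclass_self by blast
    then obtain w where w: "g' = c \<^bold>* w" unfolding Rclass_def by blast
    have "t' \<^bold>* (t R \<^bold>* g') = t' \<^bold>* (t R \<^bold>* c) \<^bold>* w" by (simp only: assoc w)
    then have "t' \<^bold>* (t R \<^bold>* g') = g'" using t'(2) w by simp
    moreover have "t R \<^bold>* g' = t R \<^bold>* g" using R *(3) by simp
    ultimately have "g = g'" by (simp only: t'(3))
    then show "g = g' \<and> R = R'" using R by simp
  qed
  moreover have "?f ` P \<subseteq> Jclass s" using key by auto
  ultimately show ?thesis using card_inj_on_le finite_Jclass by blast
qed

section \<open>Factorisation trees\<close>

definition val :: "('c \<Rightarrow> 'm) \<Rightarrow> 'c list \<Rightarrow> 'm" where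
  "val \<phi> cs = foldr (\<lambda>c x. \<phi> c \<^bold>* x) cs \<^bold>1"

lemma val_simps [simp]: "val \<phi> [] = \<^bold>1" "val \<phi> (c # cs) = \<phi> c \<^bold>* val \<phi> cs"
  by (auto simp: val_def)

lemma val_append [simp]: "val \<phi> (us @ vs) = val \<phi> us \<^bold>* val \<phi> vs"
  by (induction us) (auto simp: assoc)

text \<open>\<open>d\<close> bounds the nesting depth of the idempotent nodes, \<open>h\<close> the height.\<close>

inductive ftree :: "('c \<Rightarrow> 'm) \<Rightarrow> nat \<Rightarrow> nat \<Rightarrow> 'c list \<Rightarrow> bool" for \<phi> where
  leaf: "ftree \<phi> d h [c]"
| node: "ftree \<phi> d h us \<Longrightarrow> ftree \<phi> d h vs \<Longrightarrow> ftree \<phi> d (Suc h) (us @ vs)"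
| idem: "uss \<noteq> [] \<Longrightarrow> (\<forall>us\<in>set uss. ftree \<phi> d h us \<and> val \<phi> us = e) \<Longrightarrow> e \<^bold>* e = e
    \<Longrightarrow> ftree \<phi> (Suc d) (Suc h) (concat uss)"

lemma ftree_mono: "ftree \<phi> d h us \<Longrightarrow> d \<le> d' \<Longrightarrow> h \<le> h' \<Longrightarrow> ftree \<phi> d' h' us"
proof (induction arbitrary: d' h' rule: ftree.induct)
  case (leaf d h c)
  then show ?case by (simp add: ftree.leaf)
next
  case (node d h us vs)
  then obtain h'' where h'': "h' = Suc h''" "h \<le> h''" by (metis Suc_le_D Suc_le_mono)
  then show ?case using node by (auto intro!: ftree.node)
next
  case (idem uss d h e)
  obtain h'' where h'': "h' = Suc h''" "h \<le> h''" by (metis Suc_le_D Suc_le_mono idem.prems(2))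
  obtain d'' where d'': "d' = Suc d''" "d \<le> d''" by (metis Suc_le_D Suc_le_mono idem.prems(1))
  show ?case unfolding h''(1) d''(1)
    by (rule ftree.idem[of _ _ _ _ e]) (use idem h'' d'' in auto)
qed

text \<open>Two positions of equal type enclose a factor that fixes the prefix product, and the
  blocks following them lie in one R-class. These are the cutting points; their number of types is
  bounded by \<open>card_types_le\<close>.\<close>

fun types :: "('c \<Rightarrow> 'm) \<Rightarrow> 'm \<Rightarrow> 'c list list \<Rightarrow> ('m \<times> 'm set) set" where
  "types \<phi> g [] = {}"
| "types \<phi> g (v # vs) = insert (g, Rclass (val \<phi> v)) (types \<phi> (g \<^bold>* val \<phi> v) vs)"

lemma types_append:
  "types \<phi> g (us @ vs) = types \<phi> g us \<union> types \<phi> (g \<^bold>* val \<phi> (concat us)) vs"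
  by (induction us arbitrary: g) (auto simp: assoc)

lemma finite_types: "finite (types \<phi> g vs)"
  by (induction vs arbitrary: g) auto

lemma types_memD:
  assumes "(x, R) \<in> types \<phi> g vs"
  shows "\<exists>us us' v. vs = us @ v # us' \<and> x = g \<^bold>* val \<phi> (concat us) \<and> R = Rclass (val \<phi> v)"
  using assms
proof (induction vs arbitrary: g)
  case (Cons v vs)
  show ?case
  proof (cases "(x, R) = (g, Rclass (val \<phi> v))")
    case True
    then show ?thesis by (intro exI[of _ "[]"] exI[of _ vs] exI[of _ v]) auto
  next
    case False
    then have "(x, R) \<in> types \<phi> (g \<^bold>* val \<phi> v) vs" using Cons.prems by auto
    then obtain us us' v' where "vs = us @ v' # us'" "x = g \<^bold>* val \<phi> v \<^bold>* val \<phi> (concat us)"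
        "R = Rclass (val \<phi> v')"
      using Cons.IH by blast
    then show ?thesis by (intro exI[of _ "v # us"] exI[of _ us'] exI[of _ v']) (auto simp: assoc)
  qed
qed auto

text \<open>What matters for the recursion is that the first type does not reappear inside a block
  after its first element, so one type fewer is available there.\<close>

lemma types_split:
  assumes "vs \<noteq> []"
  shows "\<exists>yss v last. vs = concat yss @ v # last
     \<and> (\<forall>ys\<in>set yss. \<exists>v' ys'. ys = v' # ys' \<and> g \<^bold>* val \<phi> (concat ys) = g
          \<and> Rclass (val \<phi> v') = Rclass (val \<phi> (hd vs))
          \<and> (g, Rclass (val \<phi> (hd vs))) \<notin> types \<phi> (g \<^bold>* val \<phi> v') ys')
     \<and> Rclass (val \<phi> v) = Rclass (val \<phi> (hd vs))
     \<and> (g, Rclass (val \<phi> (hd vs))) \<notin> types \<phi> (g \<^bold>* val \<phi> v) last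
     \<and> g \<^bold>* val \<phi> (concat (concat yss)) = g"
  using assms
proof (induction vs rule: rev_nonempty_induct)
  case (single v)
  then show ?case by (intro exI[of _ "[]"] exI[of _ v]) auto
next
  \<comment> \<open>A new last element either has the first type and opens a fresh tail, or it
    prolongs the current tail.\<close>
  case (snoc x vs)
  let ?\<tau> = "(g, Rclass (val \<phi> (hd vs)))"
  obtain yss v last where IH: "vs = concat yss @ v # last"
     "\<forall>ys\<in>set yss. \<exists>v' ys'. ys = v' # ys' \<and> g \<^bold>* val \<phi> (concat ys) = g
          \<and> Rclass (val \<phi> v') = Rclass (val \<phi> (hd vs))
          \<and> ?\<tau> \<notin> types \<phi> (g \<^bold>* val \<phi> v') ys'"
     "Rclass (val \<phi> v) = Rclass (val \<phi> (hd vs))"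
     "?\<tau> \<notin> types \<phi> (g \<^bold>* val \<phi> v) last"
     "g \<^bold>* val \<phi> (concat (concat yss)) = g"
    using snoc.IH by blast
  have hd: "hd (vs @ [x]) = hd vs" using snoc by simp
  show ?case
  proof (cases "(g \<^bold>* val \<phi> v \<^bold>* val \<phi> (concat last), Rclass (val \<phi> x)) = ?\<tau>")
    case True
    have g: "g \<^bold>* val \<phi> (concat (v # last)) = g" using True by (simp add: assoc)
    show ?thesis unfolding hd
    proof (intro exI[of _ "yss @ [v # last]"] exI[of _ x] exI[of _ "[]"] conjI)
      show "g \<^bold>* val \<phi> (concat (concat (yss @ [v # last]))) = g"
        using g IH(5) by (simp add: assoc[symmetric])
    qed (use IH True g in auto)
  next
    case False
    show ?thesis unfolding hd
      by (intro exI[of _ yss] exI[of _ v] exI[of _ "last @ [x]"] conjI)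
        (use IH False in \<open>auto simp: types_append\<close>)
  qed
qed

text \<open>Cut the word at every position whose type is that of the first one. All blocks but the
  last then fix the prefix product \<open>g\<close>, so they are idempotents in the same L-class; they also lie
  in the same R-class, hence they are equal.\<close>

lemma smooth_ftree:
  assumes "finite P" "types \<phi> g vs \<subseteq> P" "vs \<noteq> []" "g \<in> M" "g \<preceq> s"
    and "s \<preceq> g \<^bold>* val \<phi> (concat vs)"
    and "\<forall>v\<in>set vs. val \<phi> v \<in> M \<and> val \<phi> v \<preceq> s \<and> ftree \<phi> d h v"
  shows "ftree \<phi> (d + card P) (h + 3 * card P) (concat vs)"
  using assms
\<comment> \<open>Each recursion level uses up one type. It adds an idempotent node, a binary node
  below it that detaches the first element of a block, and a binary node above it that attaches the
  tail: depth \<open>1\<close> and height \<open>3\<close>.\<close>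
proof (induction "card P" arbitrary: P g vs)
  case 0
  then have "types \<phi> g vs = {}" by auto
  then show ?case using 0 by (cases vs) auto
next
  case (Suc n)
  let ?R = "Rclass (val \<phi> (hd vs))"
  let ?\<tau> = "(g, ?R)"
  have \<tau>: "?\<tau> \<in> P" using Suc.prems by (cases vs) auto
  obtain yss v last where sp: "vs = concat yss @ v # last"
     "\<forall>ys\<in>set yss. \<exists>v' ys'. ys = v' # ys' \<and> g \<^bold>* val \<phi> (concat ys) = g
          \<and> Rclass (val \<phi> v') = ?R \<and> ?\<tau> \<notin> types \<phi> (g \<^bold>* val \<phi> v') ys'"
     "Rclass (val \<phi> v) = ?R" "?\<tau> \<notin> types \<phi> (g \<^bold>* val \<phi> v) last"
     "g \<^bold>* val \<phi> (concat (concat yss)) = g"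
    using types_split[OF Suc.prems(3), of g \<phi>] by blast
  have cl: "val \<phi> (concat us) \<in> M" if "set us \<subseteq> set vs" for us
    using that Suc.prems(7) by (induction us) auto
  have card: "card (P - {?\<tau>}) = n" using Suc \<tau> by simp
  have prefix: "s \<preceq> g \<^bold>* val \<phi> (concat (us @ us'))" and factor: "s \<preceq> val \<phi> (concat us')"
    if "vs = us @ us' @ us''" for us us' us''
  proof -
    have "val \<phi> (concat us'') \<in> M" "val \<phi> (concat us) \<in> M" using cl[of us''] cl[of us] that by auto
    then show 1: "s \<preceq> g \<^bold>* val \<phi> (concat (us @ us'))"
      using Suc.prems(6) Jle_trans Jle_multI1[of "val \<phi> (concat us'')" "g \<^bold>* val \<phi> (concat (us @ us'))"]
      by (auto simp: that assoc)
    show "s \<preceq> val \<phi> (concat us')"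
      by (rule Jle_trans[OF 1], simp add: assoc[symmetric], rule Jle_multI2)
        (use \<open>val \<phi> (concat us) \<in> M\<close> Suc.prems in auto)
  qed
  have block: "ftree \<phi> (d + n) (Suc (h + 3 * n)) (concat (v' # ys'))"
    if "?\<tau> \<notin> types \<phi> (g \<^bold>* val \<phi> v') ys'"
       "vs = us @ (v' # ys') @ us''" "g \<^bold>* val \<phi> (concat us) = g" for us v' ys' us''
  proof (cases "ys' = []")
    case True
    then show ?thesis using that Suc.prems(7) by (auto intro: ftree_mono)
  next
    case False
    have v': "val \<phi> v' \<in> M" "val \<phi> v' \<preceq> s" "ftree \<phi> d h v'" using that(2) Suc.prems(7) by auto
    have sub: "types \<phi> (g \<^bold>* val \<phi> v') ys' \<subseteq> P - {?\<tau>}"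
      using that Suc.prems(2) by (auto simp: types_append)
    have "ftree \<phi> (d + card (P - {?\<tau>})) (h + 3 * card (P - {?\<tau>})) (concat ys')"
    proof (rule Suc.hyps(1))
      show "g \<^bold>* val \<phi> v' \<preceq> s" using v' Suc.prems(4) Jle_multI2 Jle_trans by blast
      have "s \<preceq> g \<^bold>* val \<phi> (concat (us @ (v' # ys')))" using prefix that(2) by blast
      then show "s \<preceq> g \<^bold>* val \<phi> v' \<^bold>* val \<phi> (concat ys')"
        using that(3) by (simp add: assoc[symmetric])
    qed (use Suc.prems v' sub card False that(2) in auto)
    then have "ftree \<phi> (d + n) (h + 3 * n) (concat ys')" by (simp only: card)
    moreover have "ftree \<phi> (d + n) (h + 3 * n) v'" using v' by (auto intro: ftree_mono)
    ultimately show ?thesis by (auto intro: ftree.node)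
  qed
  have lastb: "ftree \<phi> (d + n) (Suc (h + 3 * n)) (concat (v # last))"
    using block[of v last "concat yss" "[]"] sp by auto
  show ?case
  proof (cases "yss = []")
    case True
    then show ?thesis using lastb sp(1) Suc(2) by (auto intro: ftree_mono)
  next
    case False
    have ys: "ftree \<phi> (d + n) (Suc (h + 3 * n)) (concat ys)
        \<and> val \<phi> (concat ys) \<in> M \<and> g \<^bold>* val \<phi> (concat ys) = g
        \<and> (\<exists>w\<in>M. val \<phi> (concat ys) = w \<^bold>* g) \<and> Rclass (val \<phi> (concat ys)) = ?R"
      if ysin: "ys \<in> set yss" for ys
    proof -
      let ?y = "val \<phi> (concat ys)"
      obtain yss1 yss2 where yss: "yss = yss1 @ ys # yss2" using split_list[OF ysin] by blast
      obtain v' ys' where v': "ys = v' # ys'" "g \<^bold>* ?y = g"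
          "Rclass (val \<phi> v') = ?R" "?\<tau> \<notin> types \<phi> (g \<^bold>* val \<phi> v') ys'"
        using bspec[OF sp(2) ysin] by blast
      have vs: "vs = concat yss1 @ ys @ concat yss2 @ v # last" using sp(1) yss by simp
      have M: "?y \<in> M" "val \<phi> v' \<in> M" "val \<phi> (concat ys') \<in> M" "val \<phi> v' \<preceq> s"
        using cl[of ys] cl[of ys'] Suc.prems(7) vs v'(1) by auto
      have g1: "g \<^bold>* val \<phi> (concat (concat yss1)) = g"
      proof -
        have "\<forall>ys\<in>set yss1. g \<^bold>* val \<phi> (concat ys) = g" using sp(2) yss by fastforce
        then show ?thesis by (induction yss1) (auto simp: assoc[symmetric])
      qed
      have sy: "s \<preceq> ?y" using factor[OF vs] .
      have ys1: "?y = val \<phi> v' \<^bold>* val \<phi> (concat ys')" using v' by simp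
      \<comment> \<open>\<open>?y\<close> is J-below \<open>s\<close>, which is J-below
        \<open>g\<close>, and \<open>g\<close> equals the product of \<open>g\<close> and
        \<open>?y\<close>. Stability then makes \<open>?y\<close> a left multiple of
        \<open>g\<close>.\<close>
      have "?y \<preceq> s" unfolding ys1 using M Jle_multI1 Jle_trans by blast
      also have "s \<preceq> g" using Suc.prems(6) cl[of vs] Jle_multI1 Jle_trans by blast
      finally have "?y \<preceq> g \<^bold>* ?y" using v' by simp
      then have "\<exists>w\<in>M. ?y = w \<^bold>* g" using stable_left[of ?y g] M Suc.prems(4) v' by auto
      moreover have "Rclass ?y = Rclass (val \<phi> v')"
        unfolding ys1 using M sy ys1 Jle_trans by (intro Rclass_mult) auto
      ultimately show ?thesis using M v' block[of v' ys' "concat yss1"] vs g1 by auto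
    qed
    define e where "e = val \<phi> (concat (hd yss))"
    have hd: "hd yss \<in> set yss" using False by simp
    \<comment> \<open>From \<open>y = w g\<close> and \<open>g y' = g\<close>, the blocks multiply
      like left zeros.\<close>
    have lz: "val \<phi> (concat y) \<^bold>* val \<phi> (concat y') = val \<phi> (concat y)"
      if y: "y \<in> set yss" "y' \<in> set yss" for y y'
    proof -
      obtain w where "val \<phi> (concat y) = w \<^bold>* g" using ys[OF y(1)] by blast
      moreover have "g \<^bold>* val \<phi> (concat y') = g" using ys[OF y(2)] by blast
      ultimately show ?thesis by (simp only: assoc)
    qed
    \<comment> \<open>R-equivalence gives \<open>y = e w\<close>, hence \<open>e y = y\<close>; the
      left zero law gives \<open>e y = e\<close>.\<close>
    have eq: "val \<phi> (concat y) = e" if y: "y \<in> set yss" for y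
    proof -
      have "val \<phi> (concat y) \<in> M" "Rclass (val \<phi> (concat y)) = Rclass e"
        using ys[OF y] ys[OF hd] unfolding e_def by simp_all
      then have "val \<phi> (concat y) \<in> Rclass e" using Rclass_self by blast
      then obtain w where w: "val \<phi> (concat y) = e \<^bold>* w" unfolding Rclass_def by blast
      have "e \<^bold>* val \<phi> (concat y) = e \<^bold>* e \<^bold>* w" unfolding w assoc ..
      then have "e \<^bold>* val \<phi> (concat y) = val \<phi> (concat y)"
        using lz[OF hd hd] unfolding w e_def by simp
      then show ?thesis using lz[OF hd y] unfolding e_def by simp
    qed
    have ee: "e \<^bold>* e = e" using lz[OF hd hd] by (simp add: e_def)
    have "ftree \<phi> (Suc (d + n)) (Suc (Suc (h + 3 * n))) (concat (map concat yss))"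
      by (rule ftree.idem[where e = e]) (use False ys eq ee in auto)
    moreover have "ftree \<phi> (Suc (d + n)) (Suc (Suc (h + 3 * n))) (concat (v # last))"
      using lastb by (auto intro: ftree_mono)
    ultimately have "ftree \<phi> (Suc (d + n)) (Suc (Suc (Suc (h + 3 * n)))) (concat (map concat yss) @ concat (v # last))"
      by (rule ftree.node)
    moreover have "concat vs = concat (map concat yss) @ concat (v # last)"
    proof -
      have "concat (concat yss) = concat (map concat yss)" by (induction yss) auto
      then show ?thesis unfolding sp(1) by simp
    qed
    ultimately show ?thesis using Suc(2) by (auto intro: ftree_mono)
  qed
qed

text \<open>Greedy cutting: a block is closed as soon as its product is J-below \<open>s\<close>.
  Without its last letter it is empty or strictly J-above \<open>s\<close>, where the induction
  hypothesis of the forest theorem applies.\<close>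

lemma split_into_Jclass:
  assumes "\<forall>c\<in>set cs. \<phi> c \<in> M" "s \<preceq> val \<phi> cs"
  shows "\<exists>vs w. cs = concat vs @ w \<and> (w = [] \<or> \<not> val \<phi> w \<preceq> s)
     \<and> (\<forall>v\<in>set vs. val \<phi> v \<preceq> s \<and> (\<exists>u c. v = u @ [c] \<and> (u = [] \<or> \<not> val \<phi> u \<preceq> s)))"
  using assms
proof (induction cs rule: rev_induct)
  case Nil
  then show ?case by (intro exI[of _ "[]"]) auto
next
  case (snoc c cs)
  have "s \<preceq> val \<phi> cs" using snoc.prems Jle_multI1 Jle_trans by fastforce
  then obtain vs w where IH: "cs = concat vs @ w" "w = [] \<or> \<not> val \<phi> w \<preceq> s"
    "\<forall>v\<in>set vs. val \<phi> v \<preceq> s \<and> (\<exists>u c. v = u @ [c] \<and> (u = [] \<or> \<not> val \<phi> u \<preceq> s))"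
    using snoc by (metis UnCI set_append)
  show ?case
  proof (cases "val \<phi> (w @ [c]) \<preceq> s")
    case True
    then show ?thesis using IH by (intro exI[of _ "vs @ [w @ [c]]"] exI[of _ "[]"]) auto
  next
    case False
    then show ?thesis using IH by (intro exI[of _ "vs"] exI[of _ "w @ [c]"]) auto
  qed
qed

text \<open>With \<open>m\<close> elements strictly above the J-class and \<open>j >= 1\<close>
  inside it, the greedy blocks have height \<open>6 m + 1\<close>, \<open>smooth_ftree\<close> adds
  \<open>3 j\<close>, and two binary nodes attach the first block and the unfinished tail. The sum
  \<open>6 m + 3 j + 3\<close> is at most \<open>6 (m + j)\<close>. Only \<open>smooth_ftree\<close>
  adds depth, at most \<open>j\<close>.\<close>

theorem factorisation_forest:
  assumes "cs \<noteq> []" "\<forall>c\<in>set cs. \<phi> c \<in> M"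
  shows "ftree \<phi> (card (up (val \<phi> cs))) (6 * card (up (val \<phi> cs))) cs"
  using assms
proof (induction "card (up (val \<phi> cs))" arbitrary: cs rule: less_induct)
  case less
  define s where "s = val \<phi> cs"
  have vM: "val \<phi> us \<in> M" if "set us \<subseteq> set cs" for us
    using that less.prems(2) by (induction us) auto
  define j where "j = card (Jclass s)"
  define m where "m = card (up s) - j"
  have sub: "Jclass s \<subseteq> up s" by (auto simp: Jclass_def up_def)
  have "s \<in> Jclass s" using vM by (auto simp: Jclass_def s_def)
  then have j: "j > 0" by (auto simp: j_def card_gt_0_iff finite_Jclass)
  have "j \<le> card (up s)" unfolding j_def by (intro card_mono finite_up sub)
  then have cu: "card (up s) = m + j" by (simp add: m_def)
  have m: "m = card (up s - Jclass s)"
    unfolding m_def j_def using sub finite_Jclass by (simp add: card_Diff_subset)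
  have above: "ftree \<phi> m (6 * m) u"
    if "u \<noteq> []" "set u \<subseteq> set cs" "s \<preceq> val \<phi> u" "\<not> val \<phi> u \<preceq> s" for u
  proof -
    have "up (val \<phi> u) \<subseteq> up s - Jclass s"
      using that Jle_trans by (auto simp: up_def Jclass_def)
    then have le: "card (up (val \<phi> u)) \<le> m" unfolding m by (intro card_mono) (auto simp: finite_up)
    then have "ftree \<phi> (card (up (val \<phi> u))) (6 * card (up (val \<phi> u))) u"
      using that less.prems j cu by (intro less.hyps) (auto simp: s_def)
    then show ?thesis using le by (auto intro: ftree_mono)
  qed
  obtain vs w where sp: "cs = concat vs @ w" "w = [] \<or> \<not> val \<phi> w \<preceq> s"
    "\<forall>v\<in>set vs. val \<phi> v \<preceq> s \<and> (\<exists>u c. v = u @ [c] \<and> (u = [] \<or> \<not> val \<phi> u \<preceq> s))"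
    using split_into_Jclass[OF less.prems(2), of s] unfolding s_def by (metis Jle_refl)
  have fac: "s \<preceq> val \<phi> us" if "cs = us1 @ us @ us2" for us us1 us2
  proof -
    have "s = val \<phi> us1 \<^bold>* val \<phi> us \<^bold>* val \<phi> us2" by (simp add: s_def that assoc)
    then show ?thesis using vM that unfolding Jle_def by auto
  qed
  have v: "val \<phi> v \<in> M \<and> val \<phi> v \<in> Jclass s \<and> ftree \<phi> m (6 * m + 1) v" if vin: "v \<in> set vs" for v
  proof -
    obtain vs1 vs2 where vs: "vs = vs1 @ v # vs2" using split_list[OF vin] by blast
    then have cs: "cs = concat vs1 @ v @ concat vs2 @ w" using sp by simp
    obtain u c where u: "v = u @ [c]" "u = [] \<or> \<not> val \<phi> u \<preceq> s" "val \<phi> v \<preceq> s" using sp(3) vin by blast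
    have "ftree \<phi> m (Suc (6 * m)) v"
    proof (cases "u = []")
      case True
      then show ?thesis using u by (auto intro: ftree.leaf)
    next
      case False
      have "s \<preceq> val \<phi> u" using fac[of "concat vs1" u "[c] @ concat vs2 @ w"] cs u by simp
      then have "ftree \<phi> m (6 * m) u" using above[OF False] u False cs by auto
      then show ?thesis unfolding u by (intro ftree.node ftree.leaf)
    qed
    moreover have "val \<phi> v \<in> M" by (rule vM) (use cs in auto)
    ultimately show ?thesis using u(3) fac[OF cs] by (simp add: Jclass_def)
  qed
  have "vs \<noteq> []"
  proof
    assume "vs = []"
    then have "w = cs" using sp by simp
    then show False using less.prems(1) sp(2) by (simp add: s_def)
  qed
  \<comment> \<open>The first block is split off so that every prefix product lies in its R-class,
    as \<open>card_types_le\<close> requires; the identity need not lie there.\<close>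
  then obtain v0 rest where vs: "vs = v0 # rest" by (cases vs) auto
  let ?g = "val \<phi> v0"
  have g: "?g \<in> M" "?g \<in> Jclass s" "ftree \<phi> m (6 * m + 1) v0" using v vs by auto
  have concat_vs: "ftree \<phi> (m + j) (6 * m + 1 + 3 * j + 1) (concat vs)"
  proof (cases "rest = []")
    case True
    then show ?thesis using g vs by (auto intro: ftree_mono)
  next
    case False
    have rM: "val \<phi> (concat us) \<in> M" if "set us \<subseteq> set vs" for us
      using that v by (induction us) auto
    have pre: "s \<preceq> ?g \<^bold>* val \<phi> (concat us)" if "rest = us @ us'" for us us'
      using fac[of "[]" "v0 @ concat us" "concat us' @ w"] sp vs that by simp
    have "card (types \<phi> ?g rest) \<le> card (Jclass s)"
    proof (rule card_types_le[OF g(2)])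
      fix x R assume "(x, R) \<in> types \<phi> ?g rest"
      then obtain us us' v' where us: "rest = us @ v' # us'" "x = ?g \<^bold>* val \<phi> (concat us)"
          "R = Rclass (val \<phi> v')"
        using types_memD by blast
      have M: "val \<phi> (concat us) \<in> M" by (rule rM) (use us vs in auto)
      have "?g \<preceq> x" using pre[OF us(1)] g(2) Jle_trans us(2) by (auto simp: Jclass_def)
      then show "Rclass x = Rclass ?g \<and> x \<in> M \<and> (\<exists>x\<in>Jclass s. R = Rclass x)"
        using M g us v vs by (auto simp: Rclass_mult)
    qed
    moreover have "ftree \<phi> (m + card (types \<phi> ?g rest)) (6 * m + 1 + 3 * card (types \<phi> ?g rest)) (concat rest)"
      using smooth_ftree[of "types \<phi> ?g rest" \<phi> ?g rest s m "6 * m + 1"] finite_types False g pre[of rest "[]"] v vs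
      by (auto simp: Jclass_def)
    ultimately have "ftree \<phi> (m + j) (6 * m + 1 + 3 * j) (concat rest)"
      by (auto simp: j_def intro: ftree_mono)
    moreover have "ftree \<phi> (m + j) (6 * m + 1 + 3 * j) v0" using g(3) by (auto intro: ftree_mono)
    ultimately show ?thesis using vs by (auto intro: ftree.node)
  qed
  have "ftree \<phi> (m + j) (Suc (6 * m + 1 + 3 * j + 1)) cs"
  proof (cases "w = []")
    case True
    then show ?thesis using concat_vs sp(1) by (auto intro: ftree_mono)
  next
    case False
    have "ftree \<phi> m (6 * m) w" using above[OF False] sp False fac[of "concat vs" w "[]"] by auto
    then have "ftree \<phi> (m + j) (6 * m + 1 + 3 * j + 1) w" by (auto intro: ftree_mono)
    then show ?thesis using concat_vs sp(1) by (auto intro: ftree.node)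
  qed
  then show ?case using cu j by (auto simp: s_def[symmetric] intro: ftree_mono)
qed

end

section \<open>Witnesses refute domination\<close>

definition bar_word :: "('q, 'a) automaton \<Rightarrow> 'a list \<Rightarrow> ('q, omega) matr" where
  "bar_word B w = (\<lambda>r s. nbar (word_mat B w r s))"

lemma bar_bar_word [simp]: "bar_mat (bar_word B w) = bar_word B w"
  by (simp add: bar_mat_def bar_word_def)

lemma bar_mat_eq_wordD:
  assumes "bar_mat N = bar_word B w"
  shows "obar (N r s) = nbar (word_mat B w r s)"
  using assms by (metis bar_mat_def bar_word_def)

lemma (in max_plus_automaton) bar_word_append:
  assumes "u \<in> lists (alphabet A)" "v \<in> lists (alphabet A)"
  shows "bar_word A (u @ v) = mat_mult (states A) (bar_word A u) (bar_word A v)"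
  unfolding bar_word_def word_mat_append[OF assms] by (rule nbar_mat_mult[OF finite_states])

lemma (in max_plus_automaton) bar_word_power:
  assumes "w \<in> lists (alphabet A)" "mat_mult (states A) (bar_word A w) (bar_word A w) = bar_word A w"
  shows "bar_word A (concat (replicate (Suc m) w)) = bar_word A w"
proof (induction m)
  case (Suc m)
  have "concat (replicate (Suc m) w) \<in> lists (alphabet A)" using assms(1) by (induction m) auto
  then have "bar_word A (w @ concat (replicate (Suc m) w)) = bar_word A w"
    using Suc assms by (subst bar_word_append) simp_all
  then show ?case by simp
qed simp

lemma (in max_plus_automaton) word_mat_single:
  assumes "a \<in> alphabet A"
  shows "word_mat A [a] = mat A a"
proof (intro ext)
  fix p q
  have "word_mat A [a] p q \<le> y \<longleftrightarrow> mat A a p q \<le> y" for y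
    using mat_support[OF assms, of p q] by (auto simp: mat_mult_def bigmax_le_iff finite_states)
  then show "word_mat A [a] p q = mat A a p q" by (metis order_antisym order_refl)
qed

section \<open>Realising elements of the semigroup by words\<close>

locale automaton_pair = A: max_plus_automaton A + B: max_plus_automaton B
  for A :: "('p, 'a) automaton" and B :: "('q, 'a) automaton" +
  assumes same_alphabet: "alphabet B = alphabet A"
begin

text \<open>The entries \<open>\<infinity>\<close> of the matrix carry no information; all others are negligible compared with
  an infinite weight of the first automaton.\<close>

definition realised_by :: "nat \<Rightarrow> 'p \<Rightarrow> omega \<Rightarrow> 'p \<Rightarrow> ('q, omega) matr \<Rightarrow> 'a list \<Rightarrow> nat \<Rightarrow> bool" where
  "realised_by n p x q N w a \<longleftrightarrow> w \<in> lists (alphabet A) \<and> Fin a \<le> word_mat A w p q \<and> bar_mat N = bar_word B w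
     \<and> (x = OOne \<longrightarrow> 1 \<le> a)
     \<and> (x = OInf \<longrightarrow> n \<le> a \<and> (\<forall>r s b. N r s \<noteq> OInf \<longrightarrow> word_mat B w r s = Fin b \<longrightarrow> n * b \<le> a))"

text \<open>The word may depend on \<open>n\<close>, that is, on how negligible the finite entries
  have to be. In a product, \<open>n\<close> can thus be chosen after the other factor is
  fixed.\<close>

definition realised :: "'p \<Rightarrow> omega \<Rightarrow> 'p \<Rightarrow> ('q, omega) matr \<Rightarrow> bool" where
  "realised p x q N \<longleftrightarrow> (\<forall>n. \<exists>w a. realised_by n p x q N w a)"

lemma realised_mono:
  assumes "realised p x q N" "bar_mat N' = bar_mat N" "\<And>r s. N r s = OInf \<Longrightarrow> N' r s = OInf"
  shows "realised p x q N'"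
  using assms unfolding realised_def realised_by_def by metis

text \<open>If only one weight is infinite, the word of the other factor is fixed first. Its entries
  are bounded by some \<open>K\<close>, and the word of infinite weight is then chosen with a
  parameter that absorbs them.\<close>

lemma realised_mult:
  assumes 1: "realised p x q N" and 2: "realised q x' q' N'"
  shows "realised p (x + x') q' (mat_mult (states B) N N')"
  unfolding realised_def
proof
  fix n
  have "\<exists>w a w' a'. realised_by n p x q N w a \<and> realised_by n q x' q' N' w' a'
     \<and> (x + x' = OInf \<longrightarrow> n \<le> a + a' \<and> (\<forall>r s t b b'. N r t \<noteq> OInf \<longrightarrow> N' t s \<noteq> OInf
         \<longrightarrow> word_mat B w r t = Fin b \<longrightarrow> word_mat B w' t s = Fin b' \<longrightarrow> n * (b + b') \<le> a + a'))"
  proof -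
    consider "x + x' \<noteq> OInf" | "x = OInf" "x' = OInf" | "x = OInf" "x' \<noteq> OInf" | "x \<noteq> OInf" "x' = OInf"
      using add_eq_OInf_iff[of x x'] by blast
    then show ?thesis
    proof cases
      case 1
      then show ?thesis using assms unfolding realised_def by blast
    next
      case 2
      obtain w a w' a' where "realised_by n p x q N w a" "realised_by n q x' q' N' w' a'"
        using assms unfolding realised_def by blast
      moreover from this have "n * (b + b') \<le> a + a'" if "N r t \<noteq> OInf" "N' t s \<noteq> OInf"
         "word_mat B w r t = Fin b" "word_mat B w' t s = Fin b'" for r s t b b'
      proof -
        have "n * b \<le> a" "n * b' \<le> a'" using calculation 2 that unfolding realised_by_def by blast+
        then show ?thesis by (simp add: distrib_left add_mono)
      qed
      moreover have "n \<le> a + a'" using calculation 2 unfolding realised_by_def by simp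
      ultimately show ?thesis by blast
    next
      case 3
      obtain w' a' where w': "realised_by n q x' q' N' w' a'"
        using assms unfolding realised_def by blast
      then have "w' \<in> lists (alphabet B)" by (simp add: realised_by_def same_alphabet)
      then obtain K where K: "\<And>r s b. word_mat B w' r s = Fin b \<Longrightarrow> b \<le> K"
        using B.word_mat_bounded by blast
      \<comment> \<open>With this parameter, half of \<open>a\<close> pays for \<open>n * b\<close>
        and the other half for \<open>n * b'\<close>, where \<open>b' <= K\<close>.\<close>
      obtain w a where w: "realised_by (2 * n * Suc K) p x q N w a"
        using assms unfolding realised_def by blast
      have bd: "n * b \<le> a \<and> 2 * (n * Suc K) \<le> a \<and> n * b * 2 \<le> a" if "N r t \<noteq> OInf" "word_mat B w r t = Fin b" for r t b
      proof -
        have "2 * n * Suc K \<le> a" "2 * n * Suc K * b \<le> a" using w 3 that unfolding realised_by_def by blast+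
        moreover have "n * b * 2 \<le> 2 * n * Suc K * b" by simp
        ultimately show ?thesis by linarith
      qed
      have na: "n \<le> a" using w 3 unfolding realised_by_def by (simp add: algebra_simps)
      then have "realised_by n p x q N w a" using w bd unfolding realised_by_def by blast
      moreover have "n * (b + b') \<le> a + a'" if "N r t \<noteq> OInf" "word_mat B w r t = Fin b" "word_mat B w' t s = Fin b'"
        for r s t b b'
      proof -
        have "b' \<le> Suc K" using K that by (simp add: le_SucI)
        then have "n * b' \<le> n * Suc K" by (rule mult_le_mono2)
        moreover have "n * b * 2 \<le> a" "2 * (n * Suc K) \<le> a" using bd that by blast+
        ultimately show ?thesis unfolding distrib_left by linarith
      qed
      ultimately show ?thesis using w' na by (meson trans_le_add1)
    next
      case 4
      obtain w a where w: "realised_by n p x q N w a"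
        using assms unfolding realised_def by blast
      then have "w \<in> lists (alphabet B)" by (simp add: realised_by_def same_alphabet)
      then obtain K where K: "\<And>r s b. word_mat B w r s = Fin b \<Longrightarrow> b \<le> K"
        using B.word_mat_bounded by blast
      obtain w' a' where w': "realised_by (2 * n * Suc K) q x' q' N' w' a'"
        using assms unfolding realised_def by blast
      have bd: "n * b \<le> a' \<and> 2 * (n * Suc K) \<le> a' \<and> n * b * 2 \<le> a'" if "N' r t \<noteq> OInf" "word_mat B w' r t = Fin b" for r t b
      proof -
        have "2 * n * Suc K \<le> a'" "2 * n * Suc K * b \<le> a'" using w' 4 that unfolding realised_by_def by blast+
        moreover have "n * b * 2 \<le> 2 * n * Suc K * b" by simp
        ultimately show ?thesis by linarith
      qed
      have na: "n \<le> a'" using w' 4 unfolding realised_by_def by (simp add: algebra_simps)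
      then have "realised_by n q x' q' N' w' a'" using w' bd unfolding realised_by_def by blast
      moreover have "n * (b + b') \<le> a + a'" if "N' t s \<noteq> OInf" "word_mat B w r t = Fin b" "word_mat B w' t s = Fin b'"
        for r s t b b'
      proof -
        have "b \<le> Suc K" using K that by (simp add: le_SucI)
        then have "n * b \<le> n * Suc K" by (rule mult_le_mono2)
        moreover have "n * b' * 2 \<le> a'" "2 * (n * Suc K) \<le> a'" using bd that by blast+
        ultimately show ?thesis unfolding distrib_left by linarith
      qed
      ultimately show ?thesis using w na by (meson trans_le_add2)
    qed
  qed
  then obtain w a w' a' where w: "realised_by n p x q N w a" and w': "realised_by n q x' q' N' w' a'"
     and ww: "x + x' = OInf \<Longrightarrow> n \<le> a + a'" "\<And>r s t b b'. x + x' = OInf \<Longrightarrow> N r t \<noteq> OInf \<Longrightarrow> N' t s \<noteq> OInf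
         \<Longrightarrow> word_mat B w r t = Fin b \<Longrightarrow> word_mat B w' t s = Fin b' \<Longrightarrow> n * (b + b') \<le> a + a'"
    by blast
  have L: "w \<in> lists (alphabet A)" "w' \<in> lists (alphabet A)" "w \<in> lists (alphabet B)" "w' \<in> lists (alphabet B)"
    using w w' by (auto simp: realised_by_def same_alphabet)
  have "realised_by n p (x + x') q' (mat_mult (states B) N N') (w @ w') (a + a')"
    unfolding realised_by_def
  proof (intro conjI impI allI)
    show "w @ w' \<in> lists (alphabet A)" using L by simp
    have "Fin a \<le> word_mat A w p q" "Fin a' \<le> word_mat A w' q q'" using w w' by (auto simp: realised_by_def)
    then have "Fin a + Fin a' \<le> word_mat A w p q + word_mat A w' q q'" by (rule add_mono)
    then show "Fin (a + a') \<le> word_mat A (w @ w') p q'"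
      using A.word_mat_append_ge[OF L(1,2), of p q q'] by (metis order_trans plus_nmax.simps(1))
    show "bar_mat (mat_mult (states B) N N') = bar_word B (w @ w')"
      using w w' L by (simp add: bar_mat_mult B.finite_states B.bar_word_append realised_by_def)
    show "1 \<le> a + a'" if "x + x' = OOne"
      using that w w' unfolding realised_by_def by (cases x; cases x') auto
    show "n \<le> a + a'" if "x + x' = OInf" using ww that by blast
    show "n * b \<le> a + a'"
      if xx: "x + x' = OInf" and rs: "mat_mult (states B) N N' r s \<noteq> OInf" "word_mat B (w @ w') r s = Fin b"
      for r s b
    proof -
      obtain t b1 b2 where t: "t \<in> states B" "word_mat B w r t = Fin b1" "word_mat B w' t s = Fin b2" "b = b1 + b2"
        by (rule B.word_mat_append_Fin[OF L(3,4) rs(2)])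
      \<comment> \<open>Neither entry on the optimal path is \<open>OMInf\<close>, so an infinite
        one would make the entry of the product infinite.\<close>
      have "obar (N r t) = nbar (Fin b1)" "obar (N' t s) = nbar (Fin b2)"
        using bar_mat_eq_wordD[of N B w r t] bar_mat_eq_wordD[of N' B w' t s] w w' t unfolding realised_by_def by auto
      then have nb: "N r t \<noteq> OMInf" "N' t s \<noteq> OMInf" by (auto split: if_splits)
      have "N r t + N' t s \<noteq> OInf"
        using rs(1) t(1) unfolding mat_mult_eq_OInf_iff[OF B.finite_states] by blast
      then have "N r t \<noteq> OInf" "N' t s \<noteq> OInf" using nb unfolding add_eq_OInf_iff by blast+
      then show ?thesis unfolding t(4) by (intro ww(2)[OF xx]) (use t in auto)
    qed
  qed
  then show "\<exists>w a. realised_by n p (x + x') q' (mat_mult (states B) N N') w a" by blast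
qed

lemma idempotent_word:
  assumes "path_idempotent_mat (states B) N" "bar_mat N = bar_word B w"
  shows "mat_mult (states B) (bar_word B w) (bar_word B w) = bar_word B w"
  using assms by (simp add: path_idempotent_mat_def)

lemma idempotent_trans:
  assumes "path_idempotent_mat (states B) N" "bar_mat N = bar_word B w" "w \<in> lists (alphabet B)"
    and "word_mat B w r s \<noteq> MInf" "word_mat B w s t \<noteq> MInf"
  shows "word_mat B w r t \<noteq> MInf"
proof -
  have "s \<in> states B" using assms B.word_mat_support by blast
  then have "mat_mult (states B) (bar_word B w) (bar_word B w) r t \<noteq> bot"
    unfolding mat_mult_eq_bot_iff[OF B.finite_states] using assms by (auto simp: bar_word_def)
  then show ?thesis using idempotent_word[OF assms(1,2)] by (simp add: bar_word_def)
qed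

text \<open>For weight \<open>OOne\<close> one word is iterated: its weight in \<open>A\<close>
  grows linearly, while an entry of \<open>B\<close> not infinite in the stabilised matrix stays
  bounded, as no positive step on its paths lies on a loop. Any other weight is unchanged by
  stabilisation, and a product of three copies suffices.\<close>

lemma realised_sharp:
  assumes N: "path_idempotent_mat (states B) N" and real: "realised p x p N"
  shows "realised p (osharp x) p (sharp_mat (states B) N)"
proof (cases "x = OOne")
  case False
  let ?Q = "states B" and ?N3 = "mat_mult (states B) (mat_mult (states B) N N) N"
  have "realised p (x + x + x) p ?N3" by (rule realised_mult[OF realised_mult[OF real real] real])
  moreover have "x + x + x = osharp x" using False by (cases x) auto
  moreover have "bar_mat ?N3 = bar_mat N" using N B.finite_states by (simp add: bar_mat_mult path_idempotent_mat_def)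
  moreover have "sharp_mat ?Q N r s = OInf" if rs: "?N3 r s = OInf" for r s
  proof -
    obtain u where u: "u \<in> ?Q" "mat_mult ?Q N N r u + N u s = OInf"
      using rs unfolding mat_mult_eq_OInf_iff[OF B.finite_states, of "mat_mult ?Q N N"] by blast
    obtain t where t: "t \<in> ?Q" "mat_mult ?Q N N r u = N r t + N t u"
      using u by (cases rule: mat_mult_cases[OF B.finite_states, of N N r u]) auto
    have tu: "t \<in> ?Q" "u \<in> ?Q" "N r t + N t u + N u s = OInf" using t u by simp_all
    let ?D = "\<lambda>p q. if p = q then osharp (N p q) else N p q"
    have "N t u \<le> ?D t u" by (cases "N t u") (auto simp: less_eq_omega_def)
    then have "N r t + N t u + N u s \<le> N r t + ?D t u + N u s"
      by (intro add_left_mono add_right_mono)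
    also have "\<dots> \<le> mat_mult ?Q N ?D r u + N u s"
      by (intro add_right_mono mat_mult_ge B.finite_states tu)
    also have "\<dots> \<le> sharp_mat ?Q N r s"
      unfolding sharp_mat_def by (intro mat_mult_ge B.finite_states tu)
    finally show ?thesis unfolding tu(3) by simp
  qed
  ultimately show ?thesis
    using realised_mono[of p "osharp x" p ?N3 "sharp_mat ?Q N"] bar_sharp_mat[OF B.finite_states N] by simp
next
  case True
  let ?Q = "states B"
  \<comment> \<open>Parameter \<open>0\<close>: what counts here is the barred matrix and
    \<open>1 <= a\<close>; growth comes from the iteration.\<close>
  obtain w a where w: "realised_by 0 p x p N w a" using real unfolding realised_def by blast
  then have wl: "w \<in> lists (alphabet A)" "w \<in> lists (alphabet B)" and bw: "bar_mat N = bar_word B w"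
    and a: "1 \<le> a" "Fin a \<le> word_mat A w p p"
    using True by (auto simp: realised_by_def same_alphabet)
  have p: "p \<in> states A" using a(2) A.word_mat_support[OF wl(1), of p p] by (cases "p \<in> states A") auto
  obtain K where K: "\<And>r s b. word_mat B w r s = Fin b \<Longrightarrow> b \<le> K"
    using B.word_mat_bounded wl by blast
  let ?e = "\<lambda>r s. word_mat B w r s \<noteq> MInf"
  have tr: "?e r t" if "?e r s" "?e s t" for r s t
    using idempotent_trans[OF N bw wl(2)] that by blast
  \<comment> \<open>The steps of positive weight. All others weigh \<open>0\<close>, so
    \<open>power_bound\<close> with \<open>G = 0\<close> gives a bound independent of
    \<open>m\<close>.\<close>
  define bad where "bad u v \<longleftrightarrow> nbar (word_mat B w u v) = OOne" for u v
  have eN: "?e r s \<longleftrightarrow> N r s \<noteq> OMInf" for r s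
    using bar_mat_eq_wordD[OF bw, of r s] by (metis obar_simps(2,7))
  have bound: "b \<le> K * Suc (card ?Q)"
    if "sharp_mat ?Q N r s \<noteq> OInf" "word_mat B (concat (replicate m w)) r s = Fin b" for r s b m
  proof -
    have "1 * b \<le> m * 0 + 1 * K * Suc (card ?Q)"
    proof (rule B.power_bound[where bad = bad])
      fix u v b assume "word_mat B w u v = Fin b" "\<not> bad u v"
      then show "1 * b \<le> 0" by (auto simp: bad_def split: if_splits)
    next
      fix u v assume *: "bad u v" "?e u v" "r = u \<or> ?e r u" "v = s \<or> ?e v s" "u = v \<or> ?e v u"
      have uQ: "u \<in> ?Q" using * B.word_mat_support[OF wl(2)] by blast
      have vQ: "v \<in> ?Q" using * B.word_mat_support[OF wl(2)] by blast
      have uu: "obar (N u u) = OOne"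
      proof (cases "u = v")
        case True
        then show ?thesis using * bar_mat_eq_wordD[OF bw, of u v] by (simp add: bad_def)
      next
        case False
        then have "?e v u" using * by blast
        \<comment> \<open>By path-idempotence, the positive step and the way back compose to a
          positive loop at \<open>u\<close>.\<close>
        have "bar_mat N u v + bar_mat N v u \<le> bar_mat N u u"
          using mat_mult_ge[OF B.finite_states vQ, of "bar_mat N" u "bar_mat N" u] N
          by (simp add: path_idempotent_mat_def)
        moreover have "bar_mat N u v = OOne" using * bar_mat_eq_wordD[OF bw, of u v] by (simp add: bad_def bar_mat_def)
        moreover have "bar_mat N v u = OZero \<or> bar_mat N v u = OOne"
          using eN[of v u] \<open>?e v u\<close> by (cases "N v u") (auto simp: bar_mat_def)
        ultimately have "OOne \<le> obar (N u u)" by (auto simp: bar_mat_def)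
        then show ?thesis by (cases "N u u") (auto simp: less_eq_omega_def)
      qed
      then have "?e u u" using eN by auto
      then have "N r u \<noteq> OMInf" "N u s \<noteq> OMInf" using * eN tr by blast+
      moreover have "osharp (N u u) = OInf" using uu by (cases "N u u") auto
      ultimately have 1: "N r u + osharp (N u u) + N u s = OInf" by (simp add: add_eq_OInf_iff)
      let ?D = "\<lambda>p q. if p = q then osharp (N p q) else N p q"
      have "N r u + ?D u u + N u s \<le> mat_mult ?Q N ?D r u + N u s"
        by (intro add_right_mono mat_mult_ge B.finite_states uQ)
      also have "\<dots> \<le> sharp_mat ?Q N r s"
        unfolding sharp_mat_def by (intro mat_mult_ge B.finite_states uQ)
      finally show False using that(1) 1 by simp
    qed (use wl tr K that in auto)
    then show ?thesis by simp
  qed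
  show ?thesis unfolding realised_def
  proof
    fix n
    define m where "m = n * (K * Suc (card ?Q)) + n"
    have "n * b \<le> Suc m * a"
      if "sharp_mat ?Q N r s \<noteq> OInf" "word_mat B (concat (replicate (Suc m) w)) r s = Fin b" for r s b
    proof -
      have "n * b \<le> n * (K * Suc (card ?Q))" using bound[OF that] by (rule mult_le_mono2)
      also have "\<dots> \<le> Suc m * 1" unfolding m_def by simp
      also have "\<dots> \<le> Suc m * a" using a by (intro mult_le_mono2)
      finally show ?thesis .
    qed
    moreover have "n \<le> Suc m * a"
    proof -
      have "n \<le> Suc m * 1" unfolding m_def by simp
      also have "\<dots> \<le> Suc m * a" using a by (intro mult_le_mono2)
      finally show ?thesis .
    qed
    moreover have "concat (replicate (Suc m) w) \<in> lists (alphabet A)" for m using wl(1) by (induction m) auto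
    moreover have "Fin (Suc m * a) \<le> word_mat A (concat (replicate (Suc m) w)) p p"
      by (rule A.word_mat_power_ge[OF wl(1) a(2) p])
    moreover have "bar_mat (sharp_mat ?Q N) = bar_word B (concat (replicate (Suc m) w))"
      using B.bar_word_power[OF wl(2) idempotent_word[OF N bw]] bar_sharp_mat[OF B.finite_states N] bw by simp
    ultimately have "realised_by n p (osharp x) p (sharp_mat ?Q N) (concat (replicate (Suc m) w)) (Suc m * a)"
      unfolding realised_by_def using True by (simp del: concat.simps replicate_Suc mult_Suc)
    then show "\<exists>w a. realised_by n p (osharp x) p (sharp_mat ?Q N) w a" by blast
  qed
qed

lemma realised_flat:
  assumes N: "path_idempotent_mat (states B) N" and real: "realised p x p N"
  shows "realised p x p (flat_mat (states B) N)"
proof (cases "x = OInf")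
  case False
  have "bar_mat (flat_mat (states B) N) = bar_mat N" by (rule bar_flat_mat[OF B.finite_states N])
  then show ?thesis using real False unfolding realised_def realised_by_def by simp
next
  case True
  let ?Q = "states B"
  show ?thesis unfolding realised_def
  proof
    fix n
    \<comment> \<open>After scaling by \<open>2 * n + 1\<close>, the good steps cost at most
      \<open>a\<close> per iteration and the off-loop infinite steps at most \<open>m\<close> in
      total, which is again at most \<open>Suc m * a\<close>. The \<open>2\<close> leaves room for
      both, and the \<open>+ 1\<close> makes \<open>a\<close> positive.\<close>
    obtain w a where w: "realised_by (2 * n + 1) p x p N w a" using real unfolding realised_def by blast
    then have wl: "w \<in> lists (alphabet A)" "w \<in> lists (alphabet B)" and bw: "bar_mat N = bar_word B w"
      and a: "2 * n + 1 \<le> a" "Fin a \<le> word_mat A w p p"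
      and small: "\<And>r s b. N r s \<noteq> OInf \<Longrightarrow> word_mat B w r s = Fin b \<Longrightarrow> (2 * n + 1) * b \<le> a"
      using True by (auto simp: realised_by_def same_alphabet)
    have p: "p \<in> states A" using a(2) A.word_mat_support[OF wl(1), of p p] by (cases "p \<in> states A") auto
    obtain K where K: "\<And>r s b. word_mat B w r s = Fin b \<Longrightarrow> b \<le> K"
      using B.word_mat_bounded wl by blast
    let ?e = "\<lambda>r s. word_mat B w r s \<noteq> MInf"
    have tr: "?e r t" if "?e r s" "?e s t" for r s t
      using idempotent_trans[OF N bw wl(2)] that by blast
    define bad where "bad u v \<longleftrightarrow> N u v = OInf" for u v
    have eN: "?e r s \<longleftrightarrow> N r s \<noteq> OMInf" for r s
      using bar_mat_eq_wordD[OF bw, of r s] by (metis obar_simps(2,7))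
    have bound: "(2 * n + 1) * b \<le> m * a + (2 * n + 1) * K * Suc (card ?Q)"
      if "flat_mat ?Q N r s \<noteq> OInf" "word_mat B (concat (replicate m w)) r s = Fin b" for r s b m
    proof (rule B.power_bound[where bad = bad])
      fix u v b assume "word_mat B w u v = Fin b" "\<not> bad u v"
      then show "(2 * n + 1) * b \<le> a" using small by (simp add: bad_def)
    next
      fix u v assume *: "bad u v" "?e u v" "r = u \<or> ?e r u" "v = s \<or> ?e v s" "u = v \<or> ?e v u"
      have uv: "u \<in> ?Q" "v \<in> ?Q" using * B.word_mat_support[OF wl(2)] by blast+
      have vu: "?e v u" using * by blast
      have uu: "?e u u" "?e r u" "?e u s" using * vu tr by blast+
      have "mat_mult ?Q (bar_mat N) (bar_mat N) v u \<noteq> bot"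
        using vu eN N by (simp add: path_idempotent_mat_def bar_mat_def)
      then obtain t where t: "t \<in> ?Q" "N v t \<noteq> OMInf" "N t u \<noteq> OMInf"
        unfolding mat_mult_eq_bot_iff[OF B.finite_states] by (auto simp: bar_mat_def)
      \<comment> \<open>Path-idempotence has split the way back at \<open>t\<close>, so the loop
        from \<open>u\<close> through \<open>v\<close> and \<open>t\<close> has exactly three steps
        and appears on the diagonal of the cube.\<close>
      let ?N3 = "mat_mult ?Q (mat_mult ?Q N N) N"
      have "mat_mult ?Q N N u t = OInf"
        unfolding mat_mult_eq_OInf_iff[OF B.finite_states] add_eq_OInf_iff using uv t * bad_def by blast
      then have N3: "?N3 u u = OInf"
        unfolding mat_mult_eq_OInf_iff[OF B.finite_states, of "mat_mult ?Q N N"] add_eq_OInf_iff using t by blast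
      have "mat_mult ?Q (bar_mat N) (bar_off_diagonal ?N3) r u = OInf"
        unfolding mat_mult_eq_OInf_iff[OF B.finite_states, of "bar_mat N"] add_eq_OInf_iff
        using uv uu N3 eN by (auto simp: bar_mat_def bar_off_diagonal_def)
      then have "flat_mat ?Q N r s = OInf"
        unfolding flat_mat_def mat_mult_eq_OInf_iff[OF B.finite_states, of _ "bar_mat N"] add_eq_OInf_iff
        using uv uu eN by (auto simp: bar_mat_def)
      then show False using that(1) by blast
    qed (use wl tr K that in auto)
    define m where "m = (2 * n + 1) * K * Suc (card ?Q)"
    have "n * b \<le> Suc m * a"
      if "flat_mat ?Q N r s \<noteq> OInf" "word_mat B (concat (replicate (Suc m) w)) r s = Fin b" for r s b
    proof -
      have "(2 * n + 1) * b \<le> Suc m * a + m" using bound[OF that] unfolding m_def by simp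
      moreover have "m \<le> Suc m * a" using a by (cases a) auto
      moreover have "(2 * n + 1) * b = 2 * (n * b) + b" by (simp add: algebra_simps)
      ultimately show ?thesis by linarith
    qed
    moreover have "n \<le> Suc m * a" using a by simp
    moreover have "concat (replicate (Suc m) w) \<in> lists (alphabet A)" for m using wl(1) by (induction m) auto
    moreover have "Fin (Suc m * a) \<le> word_mat A (concat (replicate (Suc m) w)) p p"
      by (rule A.word_mat_power_ge[OF wl(1) a(2) p])
    moreover have "bar_mat (flat_mat ?Q N) = bar_word B (concat (replicate (Suc m) w))"
      using B.bar_word_power[OF wl(2) idempotent_word[OF N bw]] bar_flat_mat[OF B.finite_states N] bw by simp
    ultimately have "realised_by n p x p (flat_mat ?Q N) (concat (replicate (Suc m) w)) (Suc m * a)"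
      unfolding realised_by_def using True by (simp del: concat.simps replicate_Suc mult_Suc)
    then show "\<exists>w a. realised_by n p x p (flat_mat ?Q N) w a" by blast
  qed
qed

lemma realised_gen:
  assumes "a \<in> alphabet A" "p \<in> states A" "q \<in> states A" "mat A a p q \<noteq> MInf"
  shows "realised p (nbar (mat A a p q)) q (\<lambda>r s. nbar (mat B a r s))"
proof -
  have "word_mat A [a] = mat A a" "word_mat B [a] = mat B a"
    using A.word_mat_single B.word_mat_single assms(1) same_alphabet by auto
  moreover obtain b where b: "mat A a p q = Fin b" using assms by (cases "mat A a p q") auto
  ultimately have "realised_by n p (nbar (mat A a p q)) q (\<lambda>r s. nbar (mat B a r s)) [a] b" for n
    using assms b unfolding realised_by_def bar_word_def bar_mat_def by auto
  then show ?thesis unfolding realised_def by blast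
qed

lemma full_semigroup_realised:
  assumes "g \<in> full_semigroup A B"
  shows "case g of Bot \<Rightarrow> True | Tup p x q N \<Rightarrow> realised p x q N"
  using assms
proof (induction rule: full_semigroup.induct)
  case (gen g)
  then show ?case using realised_gen by (auto simp: gens_def)
next
  case (mult g h)
  then show ?case by (cases g rule: elem.exhaust; cases h rule: elem.exhaust) (auto intro: realised_mult)
next
  case (stab g)
  then show ?case by (cases g rule: elem.exhaust) (auto intro: realised_sharp)
next
  case (flatten g)
  then show ?case by (cases g rule: elem.exhaust) (auto intro: realised_flat)
qed

theorem witness_imp_not_big_O:
  assumes "witness A B g"
  shows "\<not> big_O A B"
proof
  assume "big_O A B"
  then obtain c where c: "c > 0" "\<And>w. w \<in> lists (alphabet A) \<Longrightarrow> sem A w \<le> scale c (sem B w) + Fin c"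
    unfolding big_O_def by blast
  let ?Q = "states B"
  obtain p q M where g: "g \<in> full_semigroup A B" "g = Tup p OInf q M" "initial A p" "final A q"
    and small: "vec_mult ?Q (vec_mat_mult ?Q (\<lambda>r. nbar (ini B r)) M) (\<lambda>r. nbar (fin B r)) < OInf"
    using assms unfolding witness_def by blast
  have real: "realised p OInf q M" using full_semigroup_realised[OF g(1)] g(2) by simp
  have "finite (Fin -` (ini B ` ?Q \<union> fin B ` ?Q))"
    using B.finite_states by (intro finite_vimageI) (auto simp: inj_def)
  then obtain D where D: "\<forall>b\<in>Fin -` (ini B ` ?Q \<union> fin B ` ?Q). b \<le> D" by (meson finite_nat_set_iff_bounded_le)
  \<comment> \<open>From \<open>a <= c * b + c\<close> and \<open>n * b <= 2 * D * n + a\<close> one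
    gets \<open>n * a <= 2 * c * D * n + c * a + c * n\<close>. As \<open>n >= 2 * c\<close>, the
    term \<open>c * a\<close> is at most half of the left side, which leaves
    \<open>a <= 2 * c * (2 * D + 1) < n\<close>.\<close>
  define n where "n = 2 * c * (2 * D + 1) + 2 * c"
  obtain w a where w: "realised_by n p OInf q M w a" using real unfolding realised_def by blast
  then have wl: "w \<in> lists (alphabet A)" "w \<in> lists (alphabet B)" and a: "Fin a \<le> word_mat A w p q" "n \<le> a"
    and bw: "bar_mat M = bar_word B w"
    and le: "\<And>r s b. M r s \<noteq> OInf \<Longrightarrow> word_mat B w r s = Fin b \<Longrightarrow> n * b \<le> a"
    by (auto simp: realised_by_def same_alphabet)
  have pq: "p \<in> states A" "q \<in> states A" using g by (auto simp: initial_def final_def)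
  obtain i f where i: "ini A p = Fin i" "fin A q = Fin f" using g unfolding initial_def final_def by (metis nmax.exhaust)
  have "Fin a \<le> ini A p + word_mat A w p q + fin A q" using a(1) i by (cases "word_mat A w p q") auto
  also have "\<dots> \<le> sem A w" unfolding A.sem_eq[OF wl(1)] by (rule vec_mult_ge[OF A.finite_states pq])
  finally have "Fin a \<le> scale c (sem B w) + Fin c" using c(2)[OF wl(1)] by (rule order_trans)
  then obtain b where b: "sem B w = Fin b" "a \<le> c * b + c" by (cases "sem B w") auto
  have "n * b \<le> n * (2 * D) + a"
  proof (cases rule: vec_mult_cases[OF B.finite_states, of "ini B" "word_mat B w" "fin B"])
    case 1
    then show ?thesis using b(1) B.sem_eq[OF wl(2)] by simp
  next
    case (2 r s)
    then have "Fin b = ini B r + word_mat B w r s + fin B s" using b(1) B.sem_eq[OF wl(2)] by simp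
    then obtain b1 b2 b3 where bs: "ini B r = Fin b1" "word_mat B w r s = Fin b2" "fin B s = Fin b3" "b = b1 + b2 + b3"
      by (cases "ini B r"; cases "word_mat B w r s"; cases "fin B s") auto
    have "nbar (ini B r) + M r s + nbar (fin B s) \<noteq> OInf"
      using vec_mult_ge[OF B.finite_states 2(1,2), of "\<lambda>r. nbar (ini B r)" M "\<lambda>r. nbar (fin B r)"] small
      by (metis less_le_not_le omega_le_OInf)
    then have "M r s \<noteq> OInf" using bs by (auto simp: add_eq_OInf_iff split: if_splits)
    then have "n * b2 \<le> a" using le bs by blast
    moreover have "b1 \<le> D" "b3 \<le> D" using D bs 2 by force+
    then have "n * (b1 + b3) \<le> n * (2 * D)" by (intro mult_le_mono2) simp
    ultimately show ?thesis unfolding bs(4) by (simp add: algebra_simps)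
  qed
  then have "n * a \<le> c * (n * (2 * D) + a) + n * c"
  proof -
    assume *: "n * b \<le> n * (2 * D) + a"
    have "n * a \<le> n * (c * b + c)" using b(2) by (rule mult_le_mono2)
    also have "\<dots> = c * (n * b) + n * c" by (simp add: algebra_simps)
    also have "\<dots> \<le> c * (n * (2 * D) + a) + n * c" using mult_le_mono2[OF *, of c] by simp
    finally show ?thesis .
  qed
  moreover have "c * a * 2 \<le> n * a" unfolding n_def by (simp add: algebra_simps)
  moreover have "c * (n * (2 * D) + a) + n * c = n * (c * (2 * D) + c) + c * a" by (simp add: algebra_simps)
  ultimately have "n * a \<le> 2 * (n * (c * (2 * D) + c))" by linarith
  moreover have "n > 0" using c by (simp add: n_def)
  ultimately have "a \<le> 2 * (c * (2 * D) + c)" by (metis mult.left_commute mult_le_cancel1)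
  moreover have "n > 2 * (c * (2 * D) + c)" using c unfolding n_def by (simp add: algebra_simps)
  ultimately show False using a(2) by simp
qed

end

section \<open>Tractable witnesses from factorisation forests\<close>

text \<open>The support condition leaves finitely many matrices over a finite index set. This serves
  the barred semigroup and the count of candidate matrices in \<open>good_idem\<close>.\<close>

definition supported :: "'q set \<Rightarrow> ('q, omega) matr \<Rightarrow> bool" where
  "supported Q M \<longleftrightarrow> (\<forall>r s. r \<notin> Q \<or> s \<notin> Q \<longrightarrow> M r s = OMInf)"

lemma finite_omega: "finite (UNIV :: omega set)"
proof -
  have "(UNIV :: omega set) = {OMInf, OZero, OOne, OInf}"
    using omega.exhaust by blast
  then show ?thesis by (metis finite.emptyI finite.insertI)
qed

lemma finite_supported:
  assumes "finite Q"
  shows "finite {M. supported Q M}"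
proof -
  let ?F = "{f. \<forall>x. (x \<in> Q \<times> Q \<longrightarrow> f x \<in> (UNIV :: omega set)) \<and> (x \<notin> Q \<times> Q \<longrightarrow> f x = OMInf)}"
  have "finite ?F" by (rule finite_set_of_finite_funs) (auto simp: assms finite_omega)
  moreover have "{M. supported Q M} \<subseteq> curry ` ?F"
  proof
    fix M assume "M \<in> {M. supported Q M}"
    then have "M = curry (case_prod M)" "case_prod M \<in> ?F" by (auto simp: supported_def)
    then show "M \<in> curry ` ?F" by blast
  qed
  ultimately show ?thesis using finite_surj by blast
qed

lemma supported_mult: "supported Q M \<Longrightarrow> supported Q N \<Longrightarrow> finite Q \<Longrightarrow> supported Q (mat_mult Q M N)"
  unfolding supported_def using mat_mult_eq_bot_iff[of Q M N] by auto

text \<open>An infinite diagonal entry of the cube at \<open>t\<close> contains an infinite step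
  from \<open>u\<close> to \<open>v\<close> on a loop through \<open>t\<close>. Transitivity of the
  support then connects \<open>r\<close> to both \<open>u\<close> and \<open>v\<close>, and both to
  \<open>s\<close>; the two simultaneous paths of \<open>two_track\<close> need all of
  these.\<close>

lemma flat_mat_OInfD:
  assumes "finite Q" "path_idempotent_mat Q N" "flat_mat Q N r s = OInf"
  shows "\<exists>u v. N u v = OInf \<and> N v u \<noteq> OMInf \<and> N r u \<noteq> OMInf \<and> N r v \<noteq> OMInf \<and> N u s \<noteq> OMInf \<and> N v s \<noteq> OMInf \<and> u \<in> Q \<and> v \<in> Q"
proof -
  note iff = mat_mult_eq_OInf_iff[OF assms(1)]
  let ?NN = "mat_mult Q N N" let ?N3 = "mat_mult Q ?NN N"
  have nn: "?NN i j = OMInf \<longleftrightarrow> N i j = OMInf" for i j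
  proof -
    have "bar_mat ?NN = bar_mat N" using assms by (simp add: bar_mat_mult path_idempotent_mat_def)
    then have "obar (?NN i j) = obar (N i j)" by (metis bar_mat_def)
    then show ?thesis by (metis obar_simps(2))
  qed
  have n3: "?N3 i j = OMInf \<longleftrightarrow> N i j = OMInf" for i j
  proof -
    have "bar_mat ?N3 = bar_mat N" using assms by (simp add: bar_mat_mult path_idempotent_mat_def)
    then have "obar (?N3 i j) = obar (N i j)" by (metis bar_mat_def)
    then show ?thesis by (metis obar_simps(2))
  qed
  have tr: "N i l \<noteq> OMInf" if "N i j \<noteq> OMInf" "N j l \<noteq> OMInf" "j \<in> Q" for i j l
    using mat_mult_eq_bot_iff[OF assms(1), of N N i l] nn[of i l] that by auto
  obtain t' where t': "t' \<in> Q" "mat_mult Q (bar_mat N) (bar_off_diagonal ?N3) r t' + bar_mat N t' s = OInf"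
    using assms(3) unfolding flat_mat_def iff[of _ "bar_mat N"] by blast
  then have "mat_mult Q (bar_mat N) (bar_off_diagonal ?N3) r t' = OInf" "N t' s \<noteq> OMInf"
    by (auto simp: add_eq_OInf_iff bar_mat_def)
  then obtain t where t: "t \<in> Q" "N t' s \<noteq> OMInf" "N r t \<noteq> OMInf" "bar_off_diagonal ?N3 t t' = OInf"
    unfolding iff[of "bar_mat N"] by (auto simp: add_eq_OInf_iff bar_mat_def)
  then have tt: "t' = t" "?N3 t t = OInf" by (auto simp: bar_off_diagonal_def split: if_splits)
  then have Ntt: "N t t \<noteq> OMInf" using n3[of t t] by auto
  have "\<exists>u v. N u v = OInf \<and> N t u \<noteq> OMInf \<and> N v t \<noteq> OMInf \<and> u \<in> Q \<and> v \<in> Q"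
  proof -
    obtain b where b: "b \<in> Q" "?NN t b + N b t = OInf"
      using tt unfolding iff[of "?NN"] by blast
    consider "N b t = OInf" "?NN t b \<noteq> OMInf" | "?NN t b = OInf" "N b t \<noteq> OMInf"
      using b by (auto simp: add_eq_OInf_iff)
    then show ?thesis
    proof cases
      case 1
      then show ?thesis using nn b Ntt t by blast
    next
      case 2
      then obtain a where a: "a \<in> Q" "N t a + N a b = OInf" unfolding iff[of N] by blast
      have "N t a = OInf \<and> N a b \<noteq> OMInf \<or> N a b = OInf \<and> N t a \<noteq> OMInf"
        using a(2) by (simp add: add_eq_OInf_iff)
      then show ?thesis using 2(2) a(1) b(1) t(1) Ntt tr by blast
    qed
  qed
  then obtain u v where uv: "N u v = OInf" "N t u \<noteq> OMInf" "N v t \<noteq> OMInf" "u \<in> Q" "v \<in> Q" by blast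
  have "N u v \<noteq> OMInf" "N r t \<noteq> OMInf" "N t s \<noteq> OMInf" using uv t tt by auto
  then show ?thesis using uv t(1) tr by meson
qed

text \<open>With no infinite entry in \<open>M\<close>, infinity can only arise by stabilising a
  diagonal \<open>OOne\<close>.\<close>

lemma sharp_mat_OInfD:
  assumes "finite Q" "\<And>r s. M r s \<noteq> OInf" "sharp_mat Q M r s = OInf"
  shows "\<exists>t\<in>Q. M r t \<noteq> OMInf \<and> M t t = OOne \<and> M t s \<noteq> OMInf"
proof -
  note iff = mat_mult_eq_OInf_iff[OF assms(1)]
  let ?D = "\<lambda>p q. if p = q then osharp (M p q) else M p q"
  obtain t' where "t' \<in> Q" "mat_mult Q M ?D r t' + M t' s = OInf"
    using assms(3) unfolding sharp_mat_def iff[of _ M] by blast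
  then have t': "t' \<in> Q" "mat_mult Q M ?D r t' = OInf" "M t' s \<noteq> OMInf"
    using assms(2) by (auto simp: add_eq_OInf_iff)
  then obtain t where t: "t \<in> Q" "M r t + ?D t t' = OInf" unfolding iff[of M] by blast
  then have "M r t \<noteq> OMInf" "?D t t' = OInf" using assms(2) by (auto simp: add_eq_OInf_iff)
  moreover from this have "t' = t" "M t t = OOne"
    using assms(2)[of t t] assms(2)[of t t'] by (cases "t = t'"; cases "M t t"; auto)+
  ultimately show ?thesis using t t' by blast
qed

context automaton_pair
begin

section \<open>Finiteness of the barred semigroup\<close>

abbreviation "\<S> \<equiv> bar_semigroup A B"

lemma gens_form:
  assumes "g \<in> gens A B"
  obtains p q x M where "g = Tup p x q M" "p \<in> states A" "q \<in> states A" "supported (states B) M"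
  using assms B.mat_support unfolding gens_def supported_def
  by (auto simp: same_alphabet)

lemma bar_semigroup_form:
  assumes "g \<in> \<S>"
  shows "g = Bot \<or> (\<exists>p q x M. g = Tup p x q M \<and> p \<in> states A \<and> q \<in> states A \<and> supported (states B) M)"
  using assms
proof (induction rule: bar_semigroup.induct)
  case (gen g)
  then show ?case by (meson gens_form)
next
  case (mult g h)
  then show ?case
    by (cases g rule: elem.exhaust; cases h rule: elem.exhaust)
      (auto simp: supported_mult B.finite_states)
qed

lemma finite_bar_semigroup: "finite \<S>"
proof -
  let ?f = "\<lambda>(p, x, q, M). Tup p x q M"
  have "\<S> \<subseteq> insert Bot (?f ` (states A \<times> UNIV \<times> states A \<times> {M. supported (states B) M}))"
    using bar_semigroup_form by (force simp: image_iff)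
  then show ?thesis
    by (rule finite_subset) (intro finite.insertI finite_imageI finite_cartesian_product
        A.finite_states finite_omega finite_supported B.finite_states)
qed

lemma bar_monoid_mult:
  assumes "g \<in> bar_monoid A B" "h \<in> bar_monoid A B"
  shows "id_mult (states B) g h \<in> bar_monoid A B"
  using assms unfolding bar_monoid_def by (auto intro: bar_semigroup.mult)

sublocale forest: finite_submonoid "id_mult (states B)" None "bar_monoid A B"
proof
  show "finite (bar_monoid A B)" unfolding bar_monoid_def using finite_bar_semigroup by simp
qed (auto simp: id_mult_assoc B.finite_states bar_monoid_mult, auto simp: bar_monoid_def)

section \<open>Runs of \<open>A\<close> as words over its transitions\<close>

definition transitions :: "('p \<times> 'a \<times> 'p) set" where
  "transitions = {(p, a, q). a \<in> alphabet A \<and> p \<in> states A \<and> q \<in> states A \<and> mat A a p q \<noteq> MInf}"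

text \<open>The symbols of the forest are transitions rather than letters, so that a product follows
  one run of \<open>A\<close>; it is \<open>Bot\<close> if consecutive transitions do not fit
  together.\<close>

fun letter :: "'p \<times> 'a \<times> 'p \<Rightarrow> ('p, 'q) elem option" where
  "letter (p, a, q) = Some (Tup p (nbar (mat A a p q)) q (bar_word B [a]))"

fun cost :: "'p \<times> 'a \<times> 'p \<Rightarrow> nat" where
  "cost (p, a, q) = (case mat A a p q of MInf \<Rightarrow> 0 | Fin n \<Rightarrow> n)"

abbreviation "label \<equiv> map (\<lambda>(p, a, q). a)"
abbreviation "weight ts \<equiv> sum_list (map cost ts)"
abbreviation "\<V> \<equiv> forest.val letter"
abbreviation "W ts \<equiv> word_mat B (label ts)"

lemma letter_gens: "t \<in> transitions \<Longrightarrow> letter t \<in> Some ` gens A B"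
  by (cases t) (auto simp: transitions_def gens_def bar_word_def B.word_mat_single same_alphabet
      simp del: word_mat.simps intro!: image_eqI[OF refl])

lemma letter_bar_monoid: "t \<in> transitions \<Longrightarrow> letter t \<in> bar_monoid A B"
  using letter_gens unfolding bar_monoid_def by (blast intro: bar_semigroup.gen)

lemma label_lists: "set ts \<subseteq> transitions \<Longrightarrow> label ts \<in> lists (alphabet B)"
  by (induction ts) (auto simp: transitions_def same_alphabet)

lemma finite_transitions: "finite transitions"
proof (rule finite_subset)
  show "transitions \<subseteq> states A \<times> alphabet A \<times> states A" by (auto simp: transitions_def)
qed (auto simp: A.finite_states A.finite_alphabet)

lemma val_bar_semigroup:
  assumes "ts \<noteq> []" "set ts \<subseteq> transitions"
  shows "\<V> ts \<in> Some ` \<S>"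
  using assms
proof (induction ts rule: list_nonempty_induct)
  case (single t)
  then show ?case using letter_gens[of t] by (auto intro: bar_semigroup.gen)
next
  case (cons t ts)
  then obtain g h where "letter t = Some g" "g \<in> \<S>" "\<V> ts = Some h" "h \<in> \<S>"
    using letter_gens[of t] by (auto intro: bar_semigroup.gen)
  then show ?case by (auto intro: bar_semigroup.mult)
qed

lemma val_word:
  assumes "ts \<noteq> []" "set ts \<subseteq> transitions" "\<V> ts = Some (Tup p x q M)"
  shows "x = nbar (Fin (weight ts))" "M = bar_word B (label ts)"
proof -
  have "x = nbar (Fin (weight ts)) \<and> M = bar_word B (label ts)"
    using assms
  proof (induction ts arbitrary: p x q M rule: list_nonempty_induct)
    case (single t)
    then show ?case by (cases t) (auto simp: transitions_def split: nmax.splits)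
  next
    case (cons t ts)
    obtain p' a q' where t: "t = (p', a, q')" by (cases t) auto
    have ta: "a \<in> alphabet B" "mat A a p' q' \<noteq> MInf" using cons.prems t by (auto simp: transitions_def same_alphabet)
    then obtain b where b: "mat A a p' q' = Fin b" by (cases "mat A a p' q'") auto
    obtain h where h: "\<V> ts = Some h" using val_bar_semigroup[of ts] cons by auto
    then obtain p1 x1 q1 M1 where h1: "h = Tup p1 x1 q1 M1" using cons.prems t by (cases h) auto
    have IH: "x1 = nbar (Fin (weight ts))" "M1 = bar_word B (label ts)"
      using cons.IH[of p1 x1 q1 M1] cons.prems h h1 by auto
    have ls: "label ts \<in> lists (alphabet B)" using label_lists cons.prems by simp
    have "x = nbar (Fin b) + x1" "M = mat_mult (states B) (bar_word B [a]) M1"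
      using cons.prems(2) t h h1 b by (auto split: if_splits)
    moreover have "nbar (Fin b) + nbar (Fin (weight ts)) = nbar (Fin (b + weight ts))"
      unfolding nbar_add[symmetric] by simp
    ultimately show ?case using IH B.bar_word_append[of "[a]" "label ts"] ls ta t b by simp
  qed
  then show "x = nbar (Fin (weight ts))" "M = bar_word B (label ts)" by auto
qed

section \<open>Nested expressions and the certificates built from them\<close>

lemma nested_mult:
  assumes "nested A B k h" "g \<in> bar_monoid A B" "g' \<in> bar_monoid A B"
  shows "nested A B k (id_mult (states B) (id_mult (states B) g h) g')"
  using assms(1)
proof cases
  case (innermost e g1 g1')
  \<comment> \<open>By associativity the new factors merge with the outermost ones \<open>g1\<close>
    and \<open>g1'\<close>, so no operation is added.\<close>
  have "id_mult (states B) (id_mult (states B) g h) g'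
     = id_mult (states B) (id_mult (states B) (id_mult (states B) g g1) (Some (sharp (states B) e))) (id_mult (states B) g1' g')"
    unfolding innermost by (simp add: id_mult_assoc B.finite_states)
  then show ?thesis unfolding innermost(1)
    by (metis nested.innermost innermost(3-6) bar_monoid_mult assms(2,3))
next
  case (outer k' e g1 g1')
  have "id_mult (states B) (id_mult (states B) g h) g'
     = id_mult (states B) (id_mult (states B) (id_mult (states B) g g1) (Some (flat (states B) e))) (id_mult (states B) g1' g')"
    unfolding outer by (simp add: id_mult_assoc B.finite_states)
  then show ?thesis unfolding outer(1)
    by (metis nested.outer outer(3-6) bar_monoid_mult assms(2,3))
qed

lemma bar_full: "g \<in> \<S> \<Longrightarrow> g \<in> full_semigroup A B"
  by (induction rule: bar_semigroup.induct) (auto intro: full_semigroup.intros)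

lemma id_mult_full:
  assumes "h \<in> full_semigroup A B" "g \<in> bar_monoid A B" "g' \<in> bar_monoid A B"
  shows "id_mult (states B) (id_mult (states B) g (Some h)) g' \<in> Some ` full_semigroup A B"
  using assms bar_full unfolding bar_monoid_def by (auto intro!: imageI full_semigroup.mult)

lemma nested_full: "nested A B k h \<Longrightarrow> h \<in> Some ` full_semigroup A B"
proof (induction rule: nested.induct)
  case (innermost e g g')
  then show ?case by (intro id_mult_full full_semigroup.stab bar_full)
next
  case (outer k e g g')
  then have "e \<in> full_semigroup A B" by blast
  with outer show ?case by (intro id_mult_full full_semigroup.flatten)
qed

text \<open>The number \<open>a\<close> is independent of the weight of \<open>ts\<close>: a
  certificate of a factor is transported to the whole run with its own \<open>a\<close> and only
  then compared with the whole weight. Prescribing the barred matrix makes the entries of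
  \<open>N\<close> other than \<open>OMInf\<close> exactly those that \<open>B\<close> can realise
  on the run.\<close>

definition certified :: "nat \<Rightarrow> nat \<Rightarrow> ('p \<times> 'a \<times> 'p) list \<Rightarrow> nat \<Rightarrow> bool" where
  "certified C d ts a \<longleftrightarrow> (\<exists>k\<le>d. \<exists>p x q N. \<V> ts = Some (Tup p x q (bar_mat N))
     \<and> nested A B k (Some (Tup p OInf q N))
     \<and> (\<forall>r s. N r s = OInf \<longrightarrow> (\<exists>b. W ts r s = Fin b \<and> a \<le> C * b)))"

definition good :: "nat \<Rightarrow> nat \<Rightarrow> ('p \<times> 'a \<times> 'p) list \<Rightarrow> bool" where
  "good C d ts \<longleftrightarrow> weight ts \<le> C \<or> certified C d ts (weight ts)"

lemma certifiedI:
  assumes "nested A B k (Some (Tup p OInf q N))" "k \<le> d" "\<V> ts = Some (Tup p x q (bar_mat N))"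
    and "\<And>r s. N r s = OInf \<Longrightarrow> \<exists>b. W ts r s = Fin b \<and> a \<le> C * b"
  shows "certified C d ts a"
  using assms unfolding certified_def by blast

lemma certified_mono:
  assumes "certified C d ts a" "C \<le> C'" "d \<le> d'"
  shows "certified C' d' ts a"
proof -
  have "a \<le> C' * b" if "a \<le> C * b" for b using that assms(2) by (meson le_trans mult_le_mono1)
  then show ?thesis using assms(1,3) unfolding certified_def by (meson le_trans)
qed

lemma good_mono: "good C d ts \<Longrightarrow> C \<le> C' \<Longrightarrow> d \<le> d' \<Longrightarrow> good C' d' ts"
  unfolding good_def using certified_mono le_trans by blast

text \<open>The expression certifying \<open>a'\<close> fails for \<open>a\<close> at some infinite
  entry, where \<open>a' <= C * b\<close> but \<open>C' * b < a\<close>; eliminate \<open>b\<close>.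
  Thus failure to certify the whole bounds every certified part.\<close>

lemma certified_scale:
  assumes "certified C d ts a'" "\<not> certified C' d' ts a" "d \<le> d'"
  shows "C' * a' \<le> C * a"
proof -
  obtain k p x q N where N: "k \<le> d" "\<V> ts = Some (Tup p x q (bar_mat N))"
     "nested A B k (Some (Tup p OInf q N))"
     "\<forall>r s. N r s = OInf \<longrightarrow> (\<exists>b. W ts r s = Fin b \<and> a' \<le> C * b)"
    using assms(1) unfolding certified_def by blast
  have "k \<le> d'" using N(1) assms(3) by simp
  then have "\<not> (\<forall>r s. N r s = OInf \<longrightarrow> (\<exists>b. W ts r s = Fin b \<and> a \<le> C' * b))"
    using assms(2) N(2,3) unfolding certified_def by blast
  then obtain b where "a' \<le> C * b" "\<not> a \<le> C' * b" using N(4) by blast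
  have "C' * a' \<le> C' * (C * b)" using \<open>a' \<le> C * b\<close> by (rule mult_le_mono2)
  also have "\<dots> = C * (C' * b)" by (rule mult.left_commute)
  also have "\<dots> \<le> C * a" using \<open>\<not> a \<le> C' * b\<close> by (intro mult_le_mono2) simp
  finally show ?thesis .
qed

lemma W_append_ge:
  "set us \<subseteq> transitions \<Longrightarrow> set vs \<subseteq> transitions \<Longrightarrow> W us r t + W vs t s \<le> W (us @ vs) r s"
  using B.word_mat_append_ge[of "label us" "label vs"] label_lists by simp

lemma W_append_geE:
  assumes "set us \<subseteq> transitions" "set vs \<subseteq> transitions" "W us r t = Fin a" "W vs t s = Fin b"
  obtains c where "W (us @ vs) r s = Fin c" "a + b \<le> c"
  using W_append_ge[OF assms(1,2), of r t s] assms(3,4) by (cases "W (us @ vs) r s") auto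

lemma val_finite:
  assumes "ts \<noteq> []" "set ts \<subseteq> transitions" "\<V> ts = Some (Tup p x q M)"
  shows "M r s \<noteq> OInf" "bar_mat M = M" "x \<noteq> OMInf" "M r s \<noteq> OMInf \<longleftrightarrow> (\<exists>b. W ts r s = Fin b)"
proof -
  note M = val_word(2)[OF assms]
  show "M r s \<noteq> OInf" "bar_mat M = M" unfolding M by (simp_all add: bar_word_def bar_mat_def)
  show "x \<noteq> OMInf" unfolding val_word(1)[OF assms] by simp
  show "M r s \<noteq> OMInf \<longleftrightarrow> (\<exists>b. W ts r s = Fin b)"
    unfolding M by (cases "W ts r s") (simp_all add: bar_word_def)
qed

text \<open>The expression is multiplied by the barred value of the other factor, which adds no
  depth. Every infinite entry of the product passes through an infinite entry of \<open>N\<close>,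
  and extending a path does not decrease its \<open>B\<close>-weight.\<close>

lemma certified_append:
  assumes "us \<noteq> []" "vs \<noteq> []" "set us \<subseteq> transitions" "set vs \<subseteq> transitions"
    and bot: "\<V> (us @ vs) \<noteq> Some Bot"
  shows "certified C d us a \<Longrightarrow> certified C d (us @ vs) a"
    and "certified C d vs a \<Longrightarrow> certified C d (us @ vs) a"
proof -
  let ?Q = "states B"
  obtain g h where gh: "\<V> us = Some g" "\<V> vs = Some h"
    using val_bar_semigroup assms by (metis imageE)
  then have nb: "elem_mult ?Q g h \<noteq> Bot" using bot by simp
  obtain p x q M where g: "g = Tup p x q M" using nb by (cases g) auto
  then obtain x' q' M' where h: "h = Tup q x' q' M'" using nb by (cases h) (auto split: if_splits)
  have val: "\<V> (us @ vs) = Some (Tup p (x + x') q' (mat_mult ?Q M M'))" using gh g h by simp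
  have gh_mem: "Some g \<in> bar_monoid A B" "Some h \<in> bar_monoid A B"
    using val_bar_semigroup assms gh unfolding bar_monoid_def by (metis insertI2)+
  note fu = val_finite[OF assms(1,3) gh(1)[unfolded g]]
  note fv = val_finite[OF assms(2,4) gh(2)[unfolded h]]
  show "certified C d (us @ vs) a" if cu: "certified C d us a"
  proof -
    obtain k N where N: "k \<le> d" "bar_mat N = M" "nested A B k (Some (Tup p OInf q N))"
      "\<forall>r s. N r s = OInf \<longrightarrow> (\<exists>b. W us r s = Fin b \<and> a \<le> C * b)"
      using cu gh(1) g unfolding certified_def by auto
    have "nested A B k (Some (Tup p OInf q' (mat_mult ?Q N M')))"
    proof -
      have "OInf + x' = OInf" using fv(3) by (simp add: add_eq_OInf_iff)
      then show ?thesis using nested_mult[OF N(3) forest.one_closed gh_mem(2)] h by simp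
    qed
    moreover have "\<exists>b. W (us @ vs) r s = Fin b \<and> a \<le> C * b" if rs: "mat_mult ?Q N M' r s = OInf" for r s
    proof -
      obtain t where t: "N r t = OInf" "M' t s \<noteq> OMInf"
        using rs fv(1) unfolding mat_mult_eq_OInf_iff[OF B.finite_states] add_eq_OInf_iff by blast
      obtain b b' where b: "W us r t = Fin b" "a \<le> C * b" "W vs t s = Fin b'" using N(4) t fv(4) by blast
      obtain c where c: "W (us @ vs) r s = Fin c" "b + b' \<le> c" using W_append_geE[OF assms(3,4) b(1,3)] .
      have "C * b \<le> C * c" using c by (intro mult_le_mono2) simp
      then show ?thesis using c(1) b(2) le_trans by blast
    qed
    moreover have "mat_mult ?Q M M' = bar_mat (mat_mult ?Q N M')"
      using N(2) fv(2) by (simp add: bar_mat_mult B.finite_states)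
    ultimately show ?thesis unfolding certified_def val using N(1) by auto
  qed
  show "certified C d (us @ vs) a" if cv: "certified C d vs a"
  proof -
    obtain k N where N: "k \<le> d" "bar_mat N = M'" "nested A B k (Some (Tup q OInf q' N))"
      "\<forall>r s. N r s = OInf \<longrightarrow> (\<exists>b. W vs r s = Fin b \<and> a \<le> C * b)"
      using cv gh(2) h unfolding certified_def by auto
    have "nested A B k (Some (Tup p OInf q' (mat_mult ?Q M N)))"
    proof -
      have "x + OInf = OInf" using fu(3) by (simp add: add_eq_OInf_iff)
      then show ?thesis using nested_mult[OF N(3) gh_mem(1) forest.one_closed] g by simp
    qed
    moreover have "\<exists>b. W (us @ vs) r s = Fin b \<and> a \<le> C * b" if rs: "mat_mult ?Q M N r s = OInf" for r s
    proof -
      obtain t where t: "N t s = OInf" "M r t \<noteq> OMInf"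
        using rs fu(1) unfolding mat_mult_eq_OInf_iff[OF B.finite_states] add_eq_OInf_iff by blast
      obtain b b' where b: "W vs t s = Fin b" "a \<le> C * b" "W us r t = Fin b'" using N(4) t fu(4) by blast
      obtain c where c: "W (us @ vs) r s = Fin c" "b' + b \<le> c" using W_append_geE[OF assms(3,4) b(3,1)] .
      have "C * b \<le> C * c" using c by (intro mult_le_mono2) simp
      then show ?thesis using c(1) b(2) le_trans by blast
    qed
    moreover have "mat_mult ?Q M M' = bar_mat (mat_mult ?Q M N)"
      using N(2) fu(2) by (simp add: bar_mat_mult B.finite_states)
    ultimately show ?thesis unfolding certified_def val using N(1) by auto
  qed
qed

text \<open>Turns both ways of being good into one linear inequality that can be summed over the
  factors of a node.\<close>

lemma good_share:
  assumes "good C d us" "certified C d us (weight us) \<Longrightarrow> certified C d ts (weight us)"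
    and "\<not> certified C' d' ts a" "d \<le> d'"
  shows "C' * weight us \<le> C' * C + C * a"
proof (cases "weight us \<le> C")
  case True
  then show ?thesis by (simp add: trans_le_add1)
next
  case False
  then have "C' * weight us \<le> C * a"
    using assms certified_scale unfolding good_def by blast
  then show ?thesis by simp
qed

lemma good_append:
  assumes "us \<noteq> []" "vs \<noteq> []" "set us \<subseteq> transitions" "set vs \<subseteq> transitions"
    and "\<V> (us @ vs) \<noteq> Some Bot" and "good C d us" "good C d vs" "C \<ge> 1"
  shows "good (4 * C) d (us @ vs)"
proof (rule ccontr)
  let ?a = "weight (us @ vs)"
  assume "\<not> good (4 * C) d (us @ vs)"
  then have nc: "\<not> certified (4 * C) d (us @ vs) ?a" and large: "?a > 4 * C" by (auto simp: good_def)
  \<comment> \<open>The two shares add up to \<open>4 C a <= 8 C^2 + 2 C a\<close>, hence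
    \<open>a <= 4 C\<close>: this dictates the factor \<open>4\<close>.\<close>
  have "4 * C * weight us \<le> 4 * C * C + C * ?a"
    by (rule good_share[OF assms(6) certified_append(1)[OF assms(1-5)] nc]) simp_all
  moreover have "4 * C * weight vs \<le> 4 * C * C + C * ?a"
    by (rule good_share[OF assms(7) certified_append(2)[OF assms(1-5)] nc]) simp_all
  moreover have "4 * C * ?a = 4 * C * weight us + 4 * C * weight vs" by (simp add: algebra_simps)
  ultimately have "2 * (C * ?a) \<le> 8 * (C * C)" by (simp add: algebra_simps)
  moreover have "C * (4 * C) = 4 * (C * C)" by simp
  ultimately have "C * ?a \<le> C * (4 * C)" by linarith
  then show False using large assms(8) by simp
qed

text \<open>Keeping track of the two entries \<open>u\<close> and \<open>v\<close> at once, every block increases one of them by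
  its entry \<open>(u, v)\<close>.\<close>

lemma two_track:
  assumes "\<And>ys. ys \<in> set mid \<Longrightarrow> set ys \<subseteq> transitions \<and> W ys v u \<noteq> MInf
        \<and> (\<exists>b. W ys u v = Fin b \<and> \<phi> ys \<le> C * b)"
    and "set yn \<subseteq> transitions" "W yn u s \<noteq> MInf" "W yn v s \<noteq> MInf"
  shows "\<exists>b1 b2. W (concat mid @ yn) u s = Fin b1 \<and> W (concat mid @ yn) v s = Fin b2
     \<and> sum_list (map \<phi> mid) \<le> C * (b1 + b2)"
  using assms(1)
proof (induction mid)
  case Nil
  then show ?case using assms(3,4) by (cases "W yn u s"; cases "W yn v s") auto
next
  case (Cons ys mid)
  then obtain b1 b2 where IH: "W (concat mid @ yn) u s = Fin b1" "W (concat mid @ yn) v s = Fin b2"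
     "sum_list (map \<phi> mid) \<le> C * (b1 + b2)" by auto
  obtain c c' where c: "W ys u v = Fin c" "\<phi> ys \<le> C * c" "W ys v u = Fin c'"
    using Cons.prems[of ys] by (cases "W ys v u") auto
  have sub: "set ys \<subseteq> transitions" "set (concat mid @ yn) \<subseteq> transitions"
    using Cons.prems assms(2) by auto
  \<comment> \<open>A single path uses the step from \<open>u\<close> to \<open>v\<close> only in
    every second block, the other block being spent on the way back. The two paths swap roles at
    each block, so together they use it in all of them.\<close>
  obtain d1 where d1: "W (ys @ (concat mid @ yn)) u s = Fin d1" "c + b2 \<le> d1"
    using W_append_geE[OF sub c(1) IH(2)] .
  obtain d2 where d2: "W (ys @ (concat mid @ yn)) v s = Fin d2" "c' + b1 \<le> d2"
    using W_append_geE[OF sub c(3) IH(1)] .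
  have "c + (b1 + b2) \<le> d1 + d2" using d1 d2 by simp
  then have "C * (c + (b1 + b2)) \<le> C * (d1 + d2)" by (rule mult_le_mono2)
  then have "sum_list (map \<phi> (ys # mid)) \<le> C * (d1 + d2)" using IH(3) c(2) by (simp add: algebra_simps)
  then show ?case using d1 d2 by auto
qed

text \<open>The weight \<open>a\<close> is split into the first block, the last block, an amount
  \<open>C\<close> for every inner block, and the inner blocks grouped by the matrix certifying
  them. If the whole is not good, these shares multiplied by \<open>C'\<close> are at most
  \<open>C' C + C a\<close> for each outer block, \<open>2 C a\<close> for the amounts
  \<open>C\<close>, and \<open>2 C a\<close> per matrix. The choice of \<open>C'\<close> makes the
  terms in \<open>a\<close> sum to exactly half of \<open>C' a\<close>, which leaves
  \<open>a <= 4 C\<close>.\<close>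

lemma good_idem:
  assumes ne: "yss \<noteq> []" and bl: "\<And>ys. ys \<in> set yss \<Longrightarrow> ys \<noteq> [] \<and> set ys \<subseteq> transitions \<and> good C d ys \<and> \<V> ys = e"
    and ee: "id_mult (states B) e e = e" and e_bot: "e \<noteq> Some Bot"
    and C: "C \<ge> 1"
  shows "good (C * (8 + 4 * card {M. supported (states B) M})) (Suc d) (concat yss)"
proof -
  let ?Q = "states B"
  let ?\<N> = "{M. supported ?Q M}"
  define C' where "C' = C * (8 + 4 * card ?\<N>)"
  have CC': "C \<le> C'" unfolding C'_def by simp
  obtain y1 where y1: "y1 \<in> set yss" using ne by (meson hd_in_set)
  then have "\<V> y1 \<in> Some ` \<S>" using bl val_bar_semigroup by blast
  then obtain g where g: "e = Some g" "g \<in> \<S>" using bl[OF y1] by auto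
  then obtain p x q M where gT: "g = Tup p x q M" using e_bot by (cases g) auto
  then have pq: "q = p" and MM: "mat_mult ?Q M M = M" using ee g by (auto split: if_splits)
  have e: "e = Some (Tup p x p M)" using g gT pq by simp
  have sup: "supported ?Q M" using bar_semigroup_form[OF g(2)] gT by auto
  have val: "\<V> (concat zs) = e" if "zs \<noteq> []" "set zs \<subseteq> set yss" for zs
    using that
  proof (induction zs rule: list_nonempty_induct)
    case (single z)
    then show ?case using bl by simp
  next
    case (cons z zs)
    then have "\<V> z = e" "\<V> (concat zs) = e" using bl by auto
    then show ?case using ee by simp
  qed
  have y1': "y1 \<noteq> []" "set y1 \<subseteq> transitions" "\<V> y1 = Some (Tup p x p M)" using bl[OF y1] e by auto
  have Mfin: "M r s \<noteq> OInf" and barM: "bar_mat M = M" for r s using val_finite[OF y1'] by auto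
  have Wfin: "(\<exists>b. W ys r s = Fin b) \<longleftrightarrow> M r s \<noteq> OMInf" and xw: "x = nbar (Fin (weight ys))"
    and MW: "M r s = nbar (W ys r s)" if "ys \<in> set yss" for ys r s
    using val_finite(4)[of ys p x p M r s] val_word[of ys p x p M] bl[OF that] e by (auto simp: bar_word_def)
  have pim: "path_idempotent_mat ?Q N" if "bar_mat N = M" for N
    using that MM by (simp add: path_idempotent_mat_def)
  show ?thesis
  proof (cases "length yss = 1")
    case True
    then obtain ys where "yss = [ys]" by (cases yss) auto
    then show ?thesis using good_mono[of C d ys C' "Suc d"] bl CC' unfolding C'_def by simp
  next
    case False
    \<comment> \<open>The outer blocks serve as the way from \<open>r\<close> into a loop and from
      the loop to \<open>s\<close>, so they are charged separately.\<close>
    then obtain ya mid yn where yss: "yss = ya # mid @ [yn]"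
      using ne by (metis (no_types, lifting) One_nat_def append_butlast_last_id length_Cons list.exhaust list.size(3))
    let ?w = "concat yss"
    have w: "?w = ya @ (concat mid @ yn)" "?w = (ya @ concat mid) @ yn" using yss by simp_all
    have valw: "\<V> ?w = e" using val[of yss] ne by simp
    have tr: "set (concat zs) \<subseteq> transitions" if "set zs \<subseteq> set yss" for zs
      using that bl by fastforce
    show ?thesis
    proof (rule ccontr)
      assume "\<not> ?thesis"
      then have nc: "\<not> certified C' (Suc d) ?w (weight ?w)" and large: "weight ?w > C'"
        unfolding good_def C'_def by auto
      let ?a = "weight ?w"
      have ya: "ya \<in> set yss" "yn \<in> set yss" "set mid \<subseteq> set yss" using yss by auto
      have tr': "set ya \<subseteq> transitions" "set yn \<subseteq> transitions" "set (concat mid @ yn) \<subseteq> transitions"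
        "set (ya @ concat mid) \<subseteq> transitions"
        using bl[OF ya(1)] bl[OF ya(2)] tr[OF ya(3)] by auto
      have loop: "\<exists>b. W ?w r s = Fin b \<and> sum_list (map \<phi> mid) \<le> 2 * K * b"
        if r: "M r u \<noteq> OMInf" "M r v \<noteq> OMInf" "M v u \<noteq> OMInf" "M u s \<noteq> OMInf" "M v s \<noteq> OMInf"
          and \<phi>: "\<And>ys. ys \<in> set mid \<Longrightarrow> \<exists>b. W ys u v = Fin b \<and> \<phi> ys \<le> K * b" for r s u v K \<phi>
      proof -
        have "\<exists>b1 b2. W (concat mid @ yn) u s = Fin b1 \<and> W (concat mid @ yn) v s = Fin b2
           \<and> sum_list (map \<phi> mid) \<le> K * (b1 + b2)"
        proof (rule two_track)
          fix ys assume "ys \<in> set mid"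
          then show "set ys \<subseteq> transitions \<and> W ys v u \<noteq> MInf \<and> (\<exists>b. W ys u v = Fin b \<and> \<phi> ys \<le> K * b)"
            using \<phi> bl ya(3) r(3) Wfin[of ys v u] by fastforce
        qed (use tr' r Wfin[OF ya(2)] in \<open>metis nmax.distinct(1)\<close>)+
        then obtain b1 b2 where b: "W (concat mid @ yn) u s = Fin b1" "W (concat mid @ yn) v s = Fin b2"
           "sum_list (map \<phi> mid) \<le> K * (b1 + b2)" by blast
        obtain c1 c2 where c: "W ya r u = Fin c1" "W ya r v = Fin c2" using Wfin[OF ya(1)] r by metis
        obtain d1 where d1: "W ?w r s = Fin d1" "c1 + b1 \<le> d1"
          using W_append_geE[OF tr'(1,3) c(1) b(1)] unfolding w(1) .
        obtain d2 where d2: "W ?w r s = Fin d2" "c2 + b2 \<le> d2"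
          using W_append_geE[OF tr'(1,3) c(2) b(2)] unfolding w(1) .
        \<comment> \<open>Both paths have been extended to start at \<open>r\<close> and end at
          \<open>s\<close>, so each is bounded by the same entry; hence the factor
          \<open>2\<close>.\<close>
        have "b1 + b2 \<le> 2 * d1" using d1 d2 by simp
        then have "K * (b1 + b2) \<le> K * (2 * d1)" by (rule mult_le_mono2)
        moreover have "K * (2 * d1) = 2 * K * d1" by simp
        ultimately have "sum_list (map \<phi> mid) \<le> 2 * K * d1" using b(3) by linarith
        then show ?thesis using d1 by blast
      qed
      have nb: "\<V> (ya @ (concat mid @ yn)) \<noteq> Some Bot" "\<V> ((ya @ concat mid) @ yn) \<noteq> Some Bot"
        unfolding w[symmetric] using valw e_bot by simp_all
      have e1: "C' * weight ya \<le> C' * C + C * ?a"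
      proof (rule good_share[OF _ _ nc])
        show "good C d ya" using bl ya by blast
        show "certified C d ya (weight ya) \<Longrightarrow> certified C d ?w (weight ya)"
          unfolding w(1)
          by (rule certified_append(1)[OF _ _ tr'(1,3) nb(1)]) (use bl[OF ya(1)] bl[OF ya(2)] in auto)
      qed simp
      have en: "C' * weight yn \<le> C' * C + C * ?a"
      proof (rule good_share[OF _ _ nc])
        show "good C d yn" using bl ya by blast
        show "certified C d yn (weight yn) \<Longrightarrow> certified C d ?w (weight yn)"
          unfolding w(2)
          by (rule certified_append(2)[OF _ _ tr'(4,2) nb(2)]) (use bl[OF ya(1)] bl[OF ya(2)] in auto)
      qed simp
      \<comment> \<open>Stabilising the barred weight \<open>x\<close> yields \<open>OInf\<close>
        only if \<open>x\<close> is \<open>OOne\<close>.\<close>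
      have x1: "x = OOne"
      proof -
        have "x = nbar (Fin ?a)" by (rule val_word(1)) (use valw e tr[of yss] yss bl[OF ya(1)] in auto)
        moreover have "?a \<noteq> 0" using large by linarith
        ultimately show ?thesis by (simp only: nbar.simps if_False)
      qed
      \<comment> \<open>Stabilising the idempotent itself certifies the number of inner blocks,
        since each of them can be read on a loop at \<open>t\<close> of \<open>B\<close>-weight at
        least \<open>1\<close>.\<close>
      have len: "C' * length mid \<le> 2 * ?a"
      proof -
        have "certified 2 (Suc d) ?w (length mid)"
        proof (rule certifiedI)
          have "path_idempotent ?Q (Tup p x p M)" using pim barM by simp
          then have "nested A B 1 (id_mult ?Q (id_mult ?Q None (Some (sharp ?Q (Tup p x p M)))) None)"
            using g gT pq by (intro nested.innermost) auto
          then show "nested A B 1 (Some (Tup p OInf p (sharp_mat ?Q M)))" using x1 by simp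
          show "1 \<le> Suc d" by simp
          show "\<V> ?w = Some (Tup p x p (bar_mat (sharp_mat ?Q M)))"
            using valw e bar_sharp_mat[OF B.finite_states pim[OF barM]] barM by simp
          fix r s assume "sharp_mat ?Q M r s = OInf"
          then obtain t where t: "t \<in> ?Q" "M r t \<noteq> OMInf" "M t t = OOne" "M t s \<noteq> OMInf"
            using sharp_mat_OInfD[of ?Q M r s] B.finite_states Mfin by blast
          have "\<exists>b. W ?w r s = Fin b \<and> sum_list (map (\<lambda>_. 1) mid) \<le> 2 * 1 * b"
          proof (rule loop[of _ t t])
            fix ys assume "ys \<in> set mid"
            then have "OOne = nbar (W ys t t)" using MW[of ys t t] ya(3) t(3) by auto
            then show "\<exists>b. W ys t t = Fin b \<and> 1 \<le> 1 * b" by (cases "W ys t t") (auto split: if_splits)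
          qed (use t in auto)
          then show "\<exists>b. W ?w r s = Fin b \<and> length mid \<le> 2 * b" by (simp add: sum_list_triv)
        qed
        then show ?thesis using certified_scale nc by blast
      qed
      \<comment> \<open>\<open>G N ys\<close> says that \<open>N\<close> certifies the block. A
        block with several certificates is counted several times, which only enlarges the sum in
        \<open>part\<close>.\<close>
      define G where "G N ys \<longleftrightarrow> (\<exists>k\<le>d. nested A B k (Some (Tup p OInf p N))) \<and> bar_mat N = M
         \<and> (\<forall>r s. N r s = OInf \<longrightarrow> (\<exists>b. W ys r s = Fin b \<and> weight ys \<le> C * b))" for N ys
      define F where "F N ys = (if G N ys then weight ys else 0)" for N ys
      have FN: "C' * sum_list (map (F N) mid) \<le> 2 * C * ?a" for N
      proof (cases "\<exists>ys\<in>set mid. G N ys")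
        case False
        then have "sum_list (map (F N) mid) = 0" by (auto simp: F_def)
        then show ?thesis by (simp only: mult_0_right le0)
      next
        case True
        then obtain k where k: "k \<le> d" "nested A B k (Some (Tup p OInf p N))" and bN: "bar_mat N = M"
          unfolding G_def by blast
        have MN: "M i j = OMInf \<longleftrightarrow> N i j = OMInf" for i j
          unfolding bN[symmetric] bar_mat_def by simp
        have "certified (2 * C) (Suc d) ?w (sum_list (map (F N) mid))"
        proof (rule certifiedI)
          have "path_idempotent ?Q (Tup p OInf p N)" using pim bN by simp
          then have "nested A B (Suc k) (id_mult ?Q (id_mult ?Q None (Some (flat ?Q (Tup p OInf p N)))) None)"
            using k by (intro nested.outer) auto
          then show "nested A B (Suc k) (Some (Tup p OInf p (flat_mat ?Q N)))" by simp
          show "Suc k \<le> Suc d" using k by simp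
          show "\<V> ?w = Some (Tup p x p (bar_mat (flat_mat ?Q N)))"
            using valw e bar_flat_mat[OF B.finite_states pim[OF bN]] bN by simp
          fix r s assume "flat_mat ?Q N r s = OInf"
          then obtain u v where uv: "N u v = OInf" "N v u \<noteq> OMInf" "N r u \<noteq> OMInf" "N r v \<noteq> OMInf"
              "N u s \<noteq> OMInf" "N v s \<noteq> OMInf"
            using flat_mat_OInfD[OF B.finite_states pim[OF bN]] by blast
          show "\<exists>b. W ?w r s = Fin b \<and> sum_list (map (F N) mid) \<le> 2 * C * b"
          proof (rule loop[of _ u v])
            fix ys assume ys: "ys \<in> set mid"
            show "\<exists>b. W ys u v = Fin b \<and> F N ys \<le> C * b"
            proof (cases "G N ys")
              case True
              then show ?thesis using uv(1) unfolding F_def G_def by auto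
            next
              case False
              \<comment> \<open>A block that \<open>N\<close> does not certify contributes
                \<open>0\<close>, but the path must still cross it from \<open>u\<close> to
                \<open>v\<close>; it can, as its barred matrix is \<open>M\<close> too.\<close>
              have "M u v \<noteq> OMInf" using MN uv(1) by auto
              then show ?thesis using Wfin[of ys u v] ys ya(3) False unfolding F_def by auto
            qed
          qed (use uv MN in auto)
        qed
        then show ?thesis using certified_scale nc by blast
      qed
      have part: "weight ys \<le> C + (\<Sum>N\<in>?\<N>. F N ys)" if ys: "ys \<in> set mid" for ys
      proof (cases "weight ys \<le> C")
        case False
        then have "certified C d ys (weight ys)" using bl[of ys] ys ya(3) by (auto simp: good_def)
        then obtain k N where N: "k \<le> d" "nested A B k (Some (Tup p OInf p N))" "bar_mat N = M"
            "\<forall>r s. N r s = OInf \<longrightarrow> (\<exists>b. W ys r s = Fin b \<and> weight ys \<le> C * b)"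
          using bl[of ys] ys ya(3) e unfolding certified_def by auto
        then have "F N ys = weight ys" unfolding F_def G_def by auto
        moreover have "N r s = OMInf \<longleftrightarrow> M r s = OMInf" for r s unfolding N(3)[symmetric] bar_mat_def by simp
        then have "N \<in> ?\<N>" using sup by (auto simp: supported_def)
        then have "F N ys \<le> (\<Sum>N\<in>?\<N>. F N ys)"
          by (intro member_le_sum) (auto simp: finite_supported B.finite_states)
        ultimately show ?thesis by simp
      qed simp
      have "weight (concat zs) \<le> C * length zs + (\<Sum>N\<in>?\<N>. sum_list (map (F N) zs))"
        if "set zs \<subseteq> set mid" for zs
        using that
      proof (induction zs)
        case (Cons z zs)
        then have "weight z \<le> C + (\<Sum>N\<in>?\<N>. F N z)" using part by auto
        then show ?case using Cons by (simp add: sum.distrib)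
      qed simp
      then have mid: "weight (concat mid) \<le> C * length mid + (\<Sum>N\<in>?\<N>. sum_list (map (F N) mid))" by blast
      have half: "X \<le> 4 * Y" if "X \<le> 2 * Y + Z + V" "X = 2 * (Z + V)" for X Y Z V :: nat
        using that by simp
      have "C' * (\<Sum>N\<in>?\<N>. sum_list (map (F N) mid)) \<le> card ?\<N> * (2 * C * ?a)"
        unfolding sum_distrib_left using sum_bounded_above[of ?\<N> "\<lambda>N. C' * sum_list (map (F N) mid)" "2 * C * ?a"] FN
        by simp
      moreover have "C' * (C * length mid) \<le> 2 * (C * ?a)" using mult_le_mono2[OF len, of C] by (simp add: mult.left_commute)
      moreover have "C' * weight (concat mid) \<le> C' * (C * length mid) + C' * (\<Sum>N\<in>?\<N>. sum_list (map (F N) mid))"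
        using mult_le_mono2[OF mid, of C'] by (simp add: distrib_left)
      moreover have "C' * ?a = C' * weight ya + C' * weight (concat mid) + C' * weight yn"
        by (simp add: yss distrib_left)
      ultimately have "C' * ?a \<le> 2 * (C' * C) + 4 * (C * ?a) + card ?\<N> * (2 * C * ?a)" using e1 en by linarith
      moreover have "C' * ?a = 2 * (4 * (C * ?a) + card ?\<N> * (2 * C * ?a))"
        unfolding C'_def by (simp add: algebra_simps)
      ultimately have "C' * ?a \<le> 4 * (C' * C)" by (rule half)
      then have "C' * ?a \<le> C' * (4 * C)" by (simp add: mult.left_commute)
      moreover have "C' > 0" using C by (simp add: C'_def)
      ultimately have "?a \<le> 4 * C" by simp
      moreover have "4 * C \<le> C'" unfolding C'_def by simp
      ultimately show False using large by simp
    qed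
  qed
qed

section \<open>From factorisation trees to domination\<close>

lemma elem_mult_Bot_right [simp]: "elem_mult Q g Bot = Bot"
  by (cases g) auto

text \<open>Each level multiplies the constant by the factor of \<open>good_idem\<close>, which also
  covers the \<open>4\<close> of \<open>good_append\<close>. A leaf is good because its weight is at
  most \<open>L\<close>; certificates first appear at idempotent nodes.\<close>

lemma ftree_good:
  assumes "forest.ftree letter d h ts" "set ts \<subseteq> transitions" "\<V> ts \<noteq> Some Bot"
    and L: "L \<ge> 1" "\<And>t. t \<in> transitions \<Longrightarrow> cost t \<le> L"
  shows "ts \<noteq> [] \<and> good (L * (8 + 4 * card {M. supported (states B) M}) ^ h) d ts"
  using assms(1-3)
proof (induction rule: forest.ftree.induct)
  case (leaf d h t)
  have "cost t * 1 \<le> L * (8 + 4 * card {M. supported (states B) M}) ^ h"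
    using L(2)[of t] leaf by (intro mult_le_mono) auto
  then show ?case by (simp add: good_def)
next
  case (node d h us vs)
  let ?K = "8 + 4 * card {M. supported (states B) M}"
  have "\<V> us \<noteq> Some Bot" "\<V> vs \<noteq> Some Bot"
    using node.prems by (cases "\<V> us"; cases "\<V> vs"; auto)+
  then have IH: "us \<noteq> []" "vs \<noteq> []" "good (L * ?K ^ h) d us" "good (L * ?K ^ h) d vs"
    using node by auto
  have "good (4 * (L * ?K ^ h)) d (us @ vs)"
    using IH node.prems L(1) by (intro good_append) auto
  moreover have "4 * (L * ?K ^ h) \<le> L * ?K ^ Suc h" by simp
  ultimately show ?case using IH good_mono by blast
next
  case (idem uss d h e)
  let ?K = "8 + 4 * card {M. supported (states B) M}"
  have Bot_iff: "\<V> (concat zs) = Some Bot" if "us \<in> set zs" "\<V> us = Some Bot" for us zs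
    using that
  proof (induction zs)
    case (Cons z zs)
    then show ?case by (cases "\<V> z"; cases "\<V> (concat zs)") auto
  qed simp
  have us: "us \<noteq> [] \<and> set us \<subseteq> transitions \<and> good (L * ?K ^ h) d us \<and> \<V> us = e" "e \<noteq> Some Bot"
    if "us \<in> set uss" for us
    using idem.IH idem.prems that Bot_iff[OF that] by auto
  have "e \<noteq> Some Bot" using us(2) \<open>uss \<noteq> []\<close> by (meson hd_in_set)
  then have "good (L * ?K ^ h * ?K) (Suc d) (concat uss)"
    using us(1) idem.hyps L(1) by (intro good_idem) auto
  moreover have "concat uss \<noteq> []" using us(1) \<open>uss \<noteq> []\<close> by (cases uss) auto
  ultimately show ?case by (simp add: mult.assoc mult.commute mult.left_commute)
qed

lemma run_exists:
  assumes "w \<noteq> []" "w \<in> lists (alphabet A)" "word_mat A w p q = Fin a"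
  shows "\<exists>ts x M. ts \<noteq> [] \<and> set ts \<subseteq> transitions \<and> label ts = w \<and> weight ts = a \<and> \<V> ts = Some (Tup p x q M)"
  using assms
proof (induction w arbitrary: p a rule: list_nonempty_induct)
  case (single l)
  then have m: "mat A l p q = Fin a" using A.word_mat_single by simp
  then have "(p, l, q) \<in> transitions" using single A.mat_support[of l p q] by (auto simp: transitions_def)
  then show ?case using m by (intro exI[of _ "[(p, l, q)]"]) auto
next
  case (cons l w)
  have l: "[l] \<in> lists (alphabet A)" "w \<in> lists (alphabet A)" using cons by auto
  have "word_mat A ([l] @ w) p q = Fin a" using cons.prems(2) by simp
  then obtain r b1 b2 where r: "r \<in> states A" "word_mat A [l] p r = Fin b1" "word_mat A w r q = Fin b2" "a = b1 + b2"
    by (rule A.word_mat_append_Fin[OF l])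
  then have m: "mat A l p r = Fin b1" using A.word_mat_single l(1) by simp
  have t: "(p, l, r) \<in> transitions" using l m r A.mat_support[of l p r] by (auto simp: transitions_def)
  obtain ts x M where ts: "ts \<noteq> []" "set ts \<subseteq> transitions" "label ts = w" "weight ts = b2" "\<V> ts = Some (Tup r x q M)"
    using cons.IH[OF l(2) r(3)] by blast
  show ?case using ts t m r(4) by (intro exI[of _ "(p, l, r) # ts"]) auto
qed

theorem not_tractable_imp_big_O:
  assumes nat: "\<forall>w\<in>lists (alphabet B). sem B w \<in> range Fin"
    and no: "\<nexists>g. tractable_witness A B g"
  shows "big_O A B"
proof -
  let ?Q = "states B"
  have "\<exists>L. \<forall>t\<in>transitions. cost t \<le> L"
    using finite_transitions by (metis finite_imageI finite_nat_set_iff_bounded_le imageI)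
  then obtain L0 where "\<forall>t\<in>transitions. cost t \<le> L0" by blast
  then have L: "\<And>t. t \<in> transitions \<Longrightarrow> cost t \<le> Suc L0" by (simp add: le_SucI)
  define m where "m = card (bar_monoid A B)"
  define C where "C = Suc L0 * (8 + 4 * card {M. supported ?Q M}) ^ (6 * m)"
  have "finite (Fin -` (ini A ` states A \<union> fin A ` states A))"
    using A.finite_states by (intro finite_vimageI) (auto simp: inj_def)
  then obtain D where D: "\<forall>b\<in>Fin -` (ini A ` states A \<union> fin A ` states A). b \<le> D"
    by (meson finite_nat_set_iff_bounded_le)
  \<comment> \<open>\<open>2 * D\<close> pays for the initial and final weights of \<open>A\<close>,
    and the \<open>+ 1\<close> makes \<open>c\<close> positive.\<close>
  define c where "c = C + 2 * D + 1"
  have bound: "sem A w \<le> scale c (sem B w) + Fin c" if w: "w \<in> lists (alphabet A)" for w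
  proof -
    have wB: "w \<in> lists (alphabet B)" using w same_alphabet by simp
    obtain b where b: "sem B w = Fin b" using nat wB by blast
    show ?thesis
    proof (cases rule: vec_mult_cases[OF A.finite_states, of "ini A" "word_mat A w" "fin A"])
      case 1
      then show ?thesis using A.sem_eq[OF w] by simp
    next
      case (2 p q)
      then have sA: "sem A w = ini A p + word_mat A w p q + fin A q" using A.sem_eq[OF w] by simp
      show ?thesis
      proof (cases "sem A w")
        case MInf
        then show ?thesis by simp
      next
        case (Fin n)
        then obtain i a f where iaf: "ini A p = Fin i" "word_mat A w p q = Fin a" "fin A q = Fin f" "n = i + a + f"
          using sA by (cases "ini A p"; cases "word_mat A w p q"; cases "fin A q") auto
        have "i \<le> D" "f \<le> D" using D iaf 2 by force+
        then have n: "n \<le> a + 2 * D" using iaf by simp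
        have "a \<le> C * b + C"
        \<comment> \<open>Forests exist for nonempty runs only; the empty word has weight
          \<open>0\<close>.\<close>
        proof (cases "w = []")
          case True
          then show ?thesis using iaf(2) by (auto split: if_splits)
        next
          case False
          obtain ts x M where ts: "ts \<noteq> []" "set ts \<subseteq> transitions" "label ts = w" "weight ts = a"
              "\<V> ts = Some (Tup p x q M)"
            using run_exists[OF False w iaf(2)] by blast
          let ?u = "card (forest.up (\<V> ts))"
          have "?u \<le> m" unfolding m_def forest.up_def by (intro card_mono forest.finite_M) auto
          moreover have "forest.ftree letter ?u (6 * ?u) ts"
            using ts letter_bar_monoid by (intro forest.factorisation_forest) auto
          ultimately have "forest.ftree letter m (6 * m) ts" by (auto intro: forest.ftree_mono)
          then have "good C m ts" unfolding C_def using ftree_good[OF _ ts(2), of m "6 * m" "Suc L0"] ts(5) L by (simp del: mult_Suc)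
          then consider "a \<le> C" | "certified C m ts a" unfolding good_def ts(4) by blast
          then show ?thesis
          proof cases
            case 2
            then obtain k N where k: "k \<le> m" "nested A B k (Some (Tup p OInf q N))"
              "\<forall>r s. N r s = OInf \<longrightarrow> (\<exists>b. W ts r s = Fin b \<and> a \<le> C * b)"
              unfolding certified_def using ts(5) by auto
            \<comment> \<open>The adjoined identity allows \<open>m\<close> to be
              \<open>card \<S> + 1\<close>; as \<S> is nonempty, this is within
              \<open>3 * card \<S>\<close>.\<close>
            have "\<S> \<noteq> {}" using val_bar_semigroup ts by blast
            then have "1 \<le> card \<S>" using finite_bar_semigroup by (simp add: Suc_le_eq card_gt_0_iff)
            moreover have "m \<le> Suc (card \<S>)"
              unfolding m_def bar_monoid_def using finite_bar_semigroup
              by (simp add: card_insert_if card_image)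
            ultimately have "k \<le> 3 * card \<S>" using k(1) by linarith
            then have "\<not> witness A B (Tup p OInf q N)" using no k(2) unfolding tractable_witness_def by blast
            moreover have "Tup p OInf q N \<in> full_semigroup A B" using nested_full[OF k(2)] by blast
            moreover have "initial A p" "final A q" using iaf \<open>p \<in> states A\<close> \<open>q \<in> states A\<close>
              by (auto simp: initial_def final_def)
            ultimately have "\<not> vec_mult ?Q (vec_mat_mult ?Q (\<lambda>r. nbar (ini B r)) N) (\<lambda>r. nbar (fin B r)) < OInf"
              unfolding witness_def by blast
            \<comment> \<open>The only condition for a witness that can fail is the one on the
              output, which is therefore infinite. Barred initial and final weights are never
              infinite, so the infinity sits in some \<open>N r s\<close>, and the certificate
              applies there.\<close>
            then have inf: "vec_mult ?Q (vec_mat_mult ?Q (\<lambda>r. nbar (ini B r)) N) (\<lambda>r. nbar (fin B r)) = OInf"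
              by (simp add: not_less)
            obtain r s where rs: "r \<in> ?Q" "s \<in> ?Q" "nbar (ini B r) + N r s + nbar (fin B s) = OInf"
              using vec_mult_cases[OF B.finite_states, of "\<lambda>r. nbar (ini B r)" N "\<lambda>r. nbar (fin B r)"] inf
              by (metis bot_omega omega.distinct(5))
            then have "N r s = OInf" "ini B r \<noteq> MInf" "fin B s \<noteq> MInf"
              by (auto simp: add_eq_OInf_iff)
            then obtain i' b' f' where b': "word_mat B w r s = Fin b'" "a \<le> C * b'" "ini B r = Fin i'" "fin B s = Fin f'"
              using k(3) ts(3) by (metis nmax.exhaust)
            have "ini B r + word_mat B w r s + fin B s \<le> sem B w"
              unfolding B.sem_eq[OF wB] by (rule vec_mult_ge[OF B.finite_states rs(1,2)])
            then have "b' \<le> b" using b b' by simp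
            then have "C * b' \<le> C * b" by (rule mult_le_mono2)
            then show ?thesis using b'(2) by linarith
          qed simp
        qed
        moreover have "C * b \<le> c * b" unfolding c_def by (intro mult_le_mono1) simp
        ultimately have "n \<le> c * b + c" using n unfolding c_def by linarith
        then show ?thesis using Fin b by simp
      qed
    qed
  qed
  have "c > 0" by (simp add: c_def)
  then show ?thesis unfolding big_O_def using bound by blast
qed

end

theorem theorem5p3:
  fixes A :: "('p, 'a) automaton" and B :: "('q, 'a) automaton"
  assumes "max_plus_automaton A" and "max_plus_automaton B"
    and "alphabet A = alphabet B"
    and "deterministic A"
    and "\<forall>w\<in>lists (alphabet B). sem B w \<in> range Fin"
  shows "(big_O A B \<longleftrightarrow> \<not> (\<exists>g. witness A B g)) \<and>
         (big_O A B \<longleftrightarrow> \<not> (\<exists>g. tractable_witness A B g))"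
proof -
  interpret automaton_pair A B
    using assms(1-3) by (simp add: automaton_pair_def automaton_pair_axioms_def)
  have "tractable_witness A B g \<Longrightarrow> witness A B g" for g by (simp add: tractable_witness_def)
  then show ?thesis using witness_imp_not_big_O not_tractable_imp_big_O[OF assms(5)] by blast
qed

end
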